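(* Let $\bar M$ be a saturated structure (a saturated model of an arbitrary first-order theory), and let $(V,W,R)$ be a bipartite graph definable (with parameters) in $\bar M$, with $V,W$ definable sets and edge relation $R(x,y)\subseteq V\times W$, such that $R(x,y)$ is stable. Let $\mu$ be a global Keisler measure on $V$ and $\nu$ a global Keisler measure on $W$. Then for every $\epsilon>0$ we can partition $V$ into finitely many definable sets $V_1,\dots,V_m$, each defined by a $\Delta$-formula, and partition $W$ into finitely many definable sets $W_1,\dots,W_n$, each defined by a $\Delta^*$-formula, such that for each pair $V_i,W_j$ exactly one of the following holds: (i) for all $a\in V_i$ outside a set of $\mu$-measure $\le \epsilon\mu(V_i)$, for all $b\in W_j$ outside a set of $\nu$-measure $\le\epsilon\nu(W_j)$, we have $R(a,b)$; AND dually, for all $b\in W_j$ outside a set of $\nu$-measure $\le \epsilon\nu(W_j)$, for all $a\in V_i$ outside a set of $\mu$-measure $\le\epsilon\mu(V_i)$, we have $R(a,b)$; (ii) for all $a\in V_i$ outside a set of $\mu$-measure $\le \epsilon\mu(V_i)$, for all $b\in W_j$ outside a set of $\nu$-measure $\le\epsilon\nu(W_j)$, we have $\neg R(a,b)$; AND dually, for all $b\in W_j$ outside a set of $\nu$-measure $\le \epsilon\nu(W_j)$, for all $a\in V_i$ outside a set of $\mu$-measure $\le\epsilon\mu(V_i)$, we have $\neg R(a,b)$.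
   Context: Stability of $R$ means: for some $k$ there do not exist $a_i\in V$, $b_i\in W$ ($i\le k$) such that $R(a_i,b_j)$ holds iff $i\le j$. A global Keisler measure on $V$ is a finitely additive probability measure on the Boolean algebra of all subsets of $V$ definable with parameters in $\bar M$ (similarly for $W$). A $\Delta$-formula is a finite Boolean combination of formulas of the form $R(x,b)$ (with $b\in W$) and $x=a$ (with $a\in V$), with $x$ restricted to $V$, so it defines a subset of $V$. A $\Delta^*$-formula is a finite Boolean combination of formulas of the form $R(a,y)$ (with $a\in V$) and $y=b$ (with $b\in W$), with $y$ restricted to $W$, so it defines a subset of $W$.
   Formalization: For every ε>0 at least one of (i), (ii) is asserted for each pair; "exactly one" is asserted only for ε<1, since for ε≥1 the whole of V_i and W_j may be taken as exceptional sets, so both (i) and (ii) always hold. *)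

theory Defs
  imports "HOL-Analysis.Analysis"
begin

record ('f, 'r) language =
  fun_syms :: "'f set"
  rel_syms :: "'r set"
  fun_arity :: "'f \<Rightarrow> nat"
  rel_arity :: "'r \<Rightarrow> nat"

record ('f, 'r, 'm) struct =
  univ :: "'m set"
  fun_int :: "'f \<Rightarrow> 'm list \<Rightarrow> 'm"
  rel_int :: "'r \<Rightarrow> 'm list \<Rightarrow> bool"

definition is_structure :: "('f, 'r) language \<Rightarrow> ('f, 'r, 'm) struct \<Rightarrow> bool" where
  "is_structure L M \<longleftrightarrow> univ M \<noteq> {} \<and>
     (\<forall>f\<in>fun_syms L. \<forall>xs. length xs = fun_arity L f \<and> set xs \<subseteq> univ M \<longrightarrow> fun_int M f xs \<in> univ M)"

text \<open>\<open>Param a\<close> is the constant naming the element \<open>a\<close>, so that formulas with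
  \<open>params \<phi> \<subseteq> A\<close> are the formulas with parameters in \<open>A\<close>.\<close>

datatype (tm_funs: 'f, tm_params: 'm) tm =
  Var nat
| Param 'm
| App 'f "('f, 'm) tm list"

datatype (funs: 'f, rels: 'r, params: 'm) fm =
  Equal "('f, 'm) tm" "('f, 'm) tm"
| Rel 'r "('f, 'm) tm list"
| Neg "('f, 'r, 'm) fm"
| Conj "('f, 'r, 'm) fm" "('f, 'r, 'm) fm"
| Exi nat "('f, 'r, 'm) fm"

fun wf_tm :: "('f, 'r) language \<Rightarrow> ('f, 'm) tm \<Rightarrow> bool" where
  "wf_tm L (Var i) \<longleftrightarrow> True"
| "wf_tm L (Param a) \<longleftrightarrow> True"
| "wf_tm L (App f ts) \<longleftrightarrow> f \<in> fun_syms L \<and> length ts = fun_arity L f \<and> (\<forall>t\<in>set ts. wf_tm L t)"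

fun wf_fm :: "('f, 'r) language \<Rightarrow> ('f, 'r, 'm) fm \<Rightarrow> bool" where
  "wf_fm L (Equal s t) \<longleftrightarrow> wf_tm L s \<and> wf_tm L t"
| "wf_fm L (Rel r ts) \<longleftrightarrow> r \<in> rel_syms L \<and> length ts = rel_arity L r \<and> (\<forall>t\<in>set ts. wf_tm L t)"
| "wf_fm L (Neg \<phi>) \<longleftrightarrow> wf_fm L \<phi>"
| "wf_fm L (Conj \<phi> \<psi>) \<longleftrightarrow> wf_fm L \<phi> \<and> wf_fm L \<psi>"
| "wf_fm L (Exi i \<phi>) \<longleftrightarrow> wf_fm L \<phi>"

fun tm_vars :: "('f, 'm) tm \<Rightarrow> nat set" where
  "tm_vars (Var i) = {i}"
| "tm_vars (Param a) = {}"
| "tm_vars (App f ts) = (\<Union>t\<in>set ts. tm_vars t)"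

fun free_vars :: "('f, 'r, 'm) fm \<Rightarrow> nat set" where
  "free_vars (Equal s t) = tm_vars s \<union> tm_vars t"
| "free_vars (Rel r ts) = (\<Union>t\<in>set ts. tm_vars t)"
| "free_vars (Neg \<phi>) = free_vars \<phi>"
| "free_vars (Conj \<phi> \<psi>) = free_vars \<phi> \<union> free_vars \<psi>"
| "free_vars (Exi i \<phi>) = free_vars \<phi> - {i}"

fun tm_val :: "('f, 'r, 'm) struct \<Rightarrow> (nat \<Rightarrow> 'm) \<Rightarrow> ('f, 'm) tm \<Rightarrow> 'm" where
  "tm_val M e (Var i) = e i"
| "tm_val M e (Param a) = a"
| "tm_val M e (App f ts) = fun_int M f (map (tm_val M e) ts)"

fun sat :: "('f, 'r, 'm) struct \<Rightarrow> (nat \<Rightarrow> 'm) \<Rightarrow> ('f, 'r, 'm) fm \<Rightarrow> bool" where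
  "sat M e (Equal s t) \<longleftrightarrow> tm_val M e s = tm_val M e t"
| "sat M e (Rel r ts) \<longleftrightarrow> rel_int M r (map (tm_val M e) ts)"
| "sat M e (Neg \<phi>) \<longleftrightarrow> \<not> sat M e \<phi>"
| "sat M e (Conj \<phi> \<psi>) \<longleftrightarrow> sat M e \<phi> \<and> sat M e \<psi>"
| "sat M e (Exi i \<phi>) \<longleftrightarrow> (\<exists>a\<in>univ M. sat M (e(i := a)) \<phi>)"

definition formulas_over :: "('f, 'r) language \<Rightarrow> 'm set \<Rightarrow> nat \<Rightarrow> ('f, 'r, 'm) fm set" where
  "formulas_over L A n = {\<phi>. wf_fm L \<phi> \<and> params \<phi> \<subseteq> A \<and> free_vars \<phi> \<subseteq> {..<n}}"

text \<open>Tuples are lists. The tuple \<open>a\<close> is assigned to the variables \<open>0, \<dots>, n - 1\<close>; the junk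
  value of \<open>a ! i\<close> for \<open>i \<ge> n\<close> is irrelevant, as these variables are not free.\<close>

definition definable :: "('f, 'r) language \<Rightarrow> ('f, 'r, 'm) struct \<Rightarrow> nat \<Rightarrow> 'm list set \<Rightarrow> bool" where
  "definable L M n X \<longleftrightarrow> (\<exists>\<phi>\<in>formulas_over L (univ M) n.
     X = {a. length a = n \<and> set a \<subseteq> univ M \<and> sat M (\<lambda>i. a ! i) \<phi>})"

definition definable_rel ::
  "('f, 'r) language \<Rightarrow> ('f, 'r, 'm) struct \<Rightarrow> nat \<Rightarrow> nat \<Rightarrow> ('m list \<times> 'm list) set \<Rightarrow> bool" where
  "definable_rel L M n k R \<longleftrightarrow> R \<subseteq> {a. length a = n} \<times> {b. length b = k} \<and>
     definable L M (n + k) {a @ b |a b. (a, b) \<in> R}"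

text \<open>Saturated means saturated in its own cardinality: every type in one variable over a
  parameter set of size less than that of the structure is realised.\<close>

definition finitely_satisfiable :: "('f, 'r, 'm) struct \<Rightarrow> ('f, 'r, 'm) fm set \<Rightarrow> bool" where
  "finitely_satisfiable M p \<longleftrightarrow>
     (\<forall>q. finite q \<and> q \<subseteq> p \<longrightarrow> (\<exists>a\<in>univ M. \<forall>\<phi>\<in>q. sat M (\<lambda>_. a) \<phi>))"

definition saturated :: "('f, 'r) language \<Rightarrow> ('f, 'r, 'm) struct \<Rightarrow> bool" where
  "saturated L M \<longleftrightarrow>
     (\<forall>A p. A \<subseteq> univ M \<and> A \<prec> univ M \<and> p \<subseteq> formulas_over L A 1 \<and> finitely_satisfiable M p
        \<longrightarrow> (\<exists>a\<in>univ M. \<forall>\<phi>\<in>p. sat M (\<lambda>_. a) \<phi>))"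

definition definable_subsets ::
  "('f, 'r) language \<Rightarrow> ('f, 'r, 'm) struct \<Rightarrow> nat \<Rightarrow> 'm list set \<Rightarrow> 'm list set set" where
  "definable_subsets L M n V = {X. X \<subseteq> V \<and> definable L M n X}"

definition keisler_measure ::
  "('f, 'r) language \<Rightarrow> ('f, 'r, 'm) struct \<Rightarrow> nat \<Rightarrow> 'm list set \<Rightarrow> ('m list set \<Rightarrow> real) \<Rightarrow> bool" where
  "keisler_measure L M n V \<mu> \<longleftrightarrow>
     (\<forall>X\<in>definable_subsets L M n V. 0 \<le> \<mu> X) \<and> \<mu> V = 1 \<and> additive (definable_subsets L M n V) \<mu>"

definition stable_rel :: "'a set \<Rightarrow> 'b set \<Rightarrow> ('a \<times> 'b) set \<Rightarrow> bool" where
  "stable_rel V W R \<longleftrightarrow> (\<exists>k::nat. \<not> (\<exists>a b. (\<forall>i\<in>{1..k}. a i \<in> V \<and> b i \<in> W) \<and>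
     (\<forall>i\<in>{1..k}. \<forall>j\<in>{1..k}. (a i, b j) \<in> R \<longleftrightarrow> i \<le> j)))"

inductive_set boolean_combinations :: "'a set \<Rightarrow> 'a set set \<Rightarrow> 'a set set"
  for U :: "'a set" and G :: "'a set set" where
  gen: "X \<in> G \<Longrightarrow> X \<in> boolean_combinations U G"
| compl: "X \<in> boolean_combinations U G \<Longrightarrow> U - X \<in> boolean_combinations U G"
| inter: "X \<in> boolean_combinations U G \<Longrightarrow> Y \<in> boolean_combinations U G \<Longrightarrow>
    X \<inter> Y \<in> boolean_combinations U G"
| union: "X \<in> boolean_combinations U G \<Longrightarrow> Y \<in> boolean_combinations U G \<Longrightarrow>
    X \<union> Y \<in> boolean_combinations U G"

definition Delta_sets :: "'a set \<Rightarrow> 'b set \<Rightarrow> ('a \<times> 'b) set \<Rightarrow> 'a set set" where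
  "Delta_sets V W R =
     boolean_combinations V ({{x \<in> V. (x, b) \<in> R} |b. b \<in> W} \<union> {{x \<in> V. x = a} |a. a \<in> V})"

definition Delta_star_sets :: "'a set \<Rightarrow> 'b set \<Rightarrow> ('a \<times> 'b) set \<Rightarrow> 'b set set" where
  "Delta_star_sets V W R =
     boolean_combinations W ({{y \<in> W. (a, y) \<in> R} |a. a \<in> V} \<union> {{y \<in> W. y = b} |b. b \<in> W})"

text \<open>\<open>almost_all D \<mu> \<epsilon> X P\<close>: for all \<open>a \<in> X\<close> outside a set of \<open>\<mu>\<close>-measure at most
  \<open>\<epsilon> * \<mu> X\<close>, \<open>P a\<close> holds. Here \<open>D\<close> is the domain of \<open>\<mu>\<close>. If \<open>\<epsilon> \<ge> 1\<close> or \<open>\<mu> X = 0\<close>, then \<open>X\<close>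
  itself is an admissible exceptional set and the condition holds for every \<open>P\<close>.\<close>

definition almost_all :: "'a set set \<Rightarrow> ('a set \<Rightarrow> real) \<Rightarrow> real \<Rightarrow> 'a set \<Rightarrow> ('a \<Rightarrow> bool) \<Rightarrow> bool" where
  "almost_all D \<mu> \<epsilon> X P \<longleftrightarrow> (\<exists>E\<in>D. \<mu> E \<le> \<epsilon> * \<mu> X \<and> (\<forall>a\<in>X - E. P a))"

definition almost_all_pairs ::
  "'a set set \<Rightarrow> ('a set \<Rightarrow> real) \<Rightarrow> 'b set set \<Rightarrow> ('b set \<Rightarrow> real) \<Rightarrow> real \<Rightarrow>
     'a set \<Rightarrow> 'b set \<Rightarrow> ('a \<Rightarrow> 'b \<Rightarrow> bool) \<Rightarrow> bool" where
  "almost_all_pairs D \<mu> D' \<nu> \<epsilon> X Y Q \<longleftrightarrow>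
     almost_all D \<mu> \<epsilon> X (\<lambda>a. almost_all D' \<nu> \<epsilon> Y (\<lambda>b. Q a b)) \<and>
     almost_all D' \<nu> \<epsilon> Y (\<lambda>b. almost_all D \<mu> \<epsilon> X (\<lambda>a. Q a b))"

end

theory Submission
  imports Defs "HOL-Library.Ramsey"
begin

text \<open>Let \<open>A\<close> be the Boolean algebra on \<open>V\<close> generated by the sets \<open>R(x,b)\<close>, and call its
  ultrafilters types. By stability every type \<open>p\<close> is definable: \<open>{b. R(x,b) \<in> p}\<close> is a finite
  Boolean combination of sets \<open>R(a,y)\<close>. A full binary tree of sets split by the \<open>R(x,b)\<close> would have more
  branches than there are such definitions, so \<open>A\<close> is superatomic: modulo any proper ideal it has an
  atom, which determines a type.

  Apply this to the ideal of sets all of whose subsets are, up to arbitrarily small measure, finite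
  disjoint unions of sets on which \<open>\<mu>\<close> is almost concentrated on a type. If this ideal were proper,
  the type of an atom modulo it would have arbitrarily small members or a member on which \<open>\<mu>\<close> is
  almost concentrated, and the atom would belong to the ideal. Hence \<open>V\<close> has a partition into such
  sets, the small remainder being added to one of them, and likewise \<open>W\<close> for \<open>\<nu>\<close>.

  The definition of a type \<open>p\<close> on \<open>V\<close> belongs to a type \<open>q\<close> on \<open>W\<close> iff the definition of \<open>q\<close>
  belongs to \<open>p\<close> (Harrington). So a pair of pieces with types \<open>p\<close> and \<open>q\<close> is almost complete or
  almost empty according to whether the definition of \<open>q\<close> belongs to \<open>p\<close>.\<close>

section \<open>Pairwise related and monochromatic sequences\<close>

lemma exists_pairwise_sequence:
  assumes extend: "\<And>F. finite F \<Longrightarrow> F \<subseteq> S \<Longrightarrow> \<exists>x\<in>S. \<forall>y\<in>F. P y x"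
  shows "\<exists>f :: nat \<Rightarrow> 'a. (\<forall>n. f n \<in> S) \<and> (\<forall>i j. i < j \<longrightarrow> P (f i) (f j))"
proof -
  obtain g where g: "\<And>F. finite F \<Longrightarrow> F \<subseteq> S \<Longrightarrow> g F \<in> S \<and> (\<forall>y\<in>F. P y (g F))"
    using extend by metis
  define history where "history = rec_nat {} (\<lambda>_ F. insert (g F) F)"
  have history_0: "history 0 = {}"
    and history_Suc: "history (Suc n) = insert (g (history n)) (history n)" for n
    by (simp_all add: history_def)
  have history: "finite (history n) \<and> history n \<subseteq> S" for n
    by (induction n) (use g in \<open>auto simp: history_0 history_Suc\<close>)
  have "g (history i) \<in> history j" if "i < j" for i j
    using that by (induction j) (auto simp: history_Suc less_Suc_eq)
  then have "P (g (history i)) (g (history j))" if "i < j" for i j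
    using that g[of "history j"] history[of j] by simp
  moreover have "g (history n) \<in> S" for n
    using g[of "history n"] history[of n] by simp
  ultimately show ?thesis by (intro exI conjI allI impI)
qed

lemma exists_monochromatic_subsequence:
  fixes P :: "nat \<Rightarrow> nat \<Rightarrow> bool"
  shows "\<exists>e :: nat \<Rightarrow> nat. strict_mono e \<and> (\<exists>c. \<forall>i j. i < j \<longrightarrow> P (e i) (e j) = c)"
proof -
  define colour :: "nat set \<Rightarrow> nat" where "colour S = (if P (Min S) (Max S) then 1 else 0)" for S
  have "\<forall>x\<in>UNIV. \<forall>y\<in>UNIV. x \<noteq> y \<longrightarrow> colour {x, y} < 2"
    by (simp add: colour_def)
  from Ramsey2[OF infinite_UNIV_nat this] obtain Y t
    where Y: "infinite Y" "\<forall>x\<in>Y. \<forall>y\<in>Y. x \<noteq> y \<longrightarrow> colour {x, y} = t"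
    by blast
  have mono: "strict_mono (enumerate Y)" using Y(1) by (rule strict_mono_enumerate)
  have "P (enumerate Y i) (enumerate Y j) \<longleftrightarrow> t = 1" if "i < j" for i j
  proof -
    have less: "enumerate Y i < enumerate Y j" using mono that by (rule strict_monoD)
    then have "enumerate Y i \<noteq> enumerate Y j" by simp
    then have "colour {enumerate Y i, enumerate Y j} = t"
      using Y(2) enumerate_in_set[OF Y(1)] by blast
    with less show ?thesis by (auto simp: colour_def min_def max_def split: if_splits)
  qed
  with mono show ?thesis by blast
qed

section \<open>Stable relations\<close>

definition ladder ::
  "'a set \<Rightarrow> 'b set \<Rightarrow> ('a \<times> 'b) set \<Rightarrow> nat \<Rightarrow> (nat \<Rightarrow> 'a) \<Rightarrow> (nat \<Rightarrow> 'b) \<Rightarrow> bool" where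
  "ladder V W R k a b \<longleftrightarrow> (\<forall>i\<in>{1..k}. a i \<in> V \<and> b i \<in> W) \<and>
     (\<forall>i\<in>{1..k}. \<forall>j\<in>{1..k}. (a i, b j) \<in> R \<longleftrightarrow> i \<le> j)"

lemma stable_rel_iff_no_ladder: "stable_rel V W R \<longleftrightarrow> (\<exists>k. \<forall>a b. \<not> ladder V W R k a b)"
  by (simp add: stable_rel_def ladder_def)

lemma ladder_mono: "ladder V' W' R k a b \<Longrightarrow> V' \<subseteq> V \<Longrightarrow> W' \<subseteq> W \<Longrightarrow> ladder V W R k a b"
  unfolding ladder_def by (simp add: subset_iff)

lemma stable_rel_mono:
  assumes "stable_rel V W R" "V' \<subseteq> V" "W' \<subseteq> W"
  shows "stable_rel V' W' R"
proof -
  obtain k where no_ladder: "\<And>a b. \<not> ladder V W R k a b"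
    using assms(1) unfolding stable_rel_iff_no_ladder by blast
  have "\<not> ladder V' W' R k a b" for a b
    using no_ladder by (rule contrapos_nn) (rule ladder_mono[OF _ assms(2,3)])
  then show ?thesis unfolding stable_rel_iff_no_ladder by (intro exI allI)
qed

lemma ladder_converse:
  assumes "ladder W V (R\<inverse>) k b a"
  shows "ladder V W R k (\<lambda>i. a (k + 1 - i)) (\<lambda>j. b (k + 1 - j))"
proof -
  have reversed: "k + 1 - i \<in> {1..k}" if "i \<in> {1..k}" for i using that by auto
  have "(a (k + 1 - i), b (k + 1 - j)) \<in> R \<longleftrightarrow> i \<le> j" if "i \<in> {1..k}" "j \<in> {1..k}" for i j
    using assms reversed[OF that(1)] reversed[OF that(2)] that unfolding ladder_def by fastforce
  with assms reversed show ?thesis by (simp add: ladder_def)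
qed

lemma stable_rel_converse:
  assumes "stable_rel V W R"
  shows "stable_rel W V (R\<inverse>)"
proof -
  obtain k where no_ladder: "\<And>a b. \<not> ladder V W R k a b"
    using assms unfolding stable_rel_iff_no_ladder by blast
  have "\<not> ladder W V (R\<inverse>) k b a" for a b
    using no_ladder by (rule contrapos_nn) (rule ladder_converse)
  then show ?thesis unfolding stable_rel_iff_no_ladder by (intro exI allI)
qed

lemma stable_rel_no_infinite_ladder:
  fixes a :: "nat \<Rightarrow> 'a" and b :: "nat \<Rightarrow> 'b"
  assumes "stable_rel V W R" "\<And>i. a i \<in> V" "\<And>i. b i \<in> W"
  shows "\<not> (\<forall>i j. (a i, b j) \<in> R \<longleftrightarrow> i \<le> j)"
proof
  assume "\<forall>i j. (a i, b j) \<in> R \<longleftrightarrow> i \<le> j"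
  then have "ladder V W R k a b" for k using assms(2,3) by (simp add: ladder_def)
  with assms(1) show False by (auto simp: stable_rel_iff_no_ladder)
qed

lemma stable_rel_no_twin_sequences:
  fixes a :: "nat \<Rightarrow> 'a" and b c :: "nat \<Rightarrow> 'b"
  assumes stable: "stable_rel V W R" and in_VW: "\<And>i. a i \<in> V" "\<And>i. b i \<in> W" "\<And>i. c i \<in> W"
    and below: "\<And>i j. i \<le> j \<Longrightarrow> (a j, b i) \<in> R \<and> (a j, c i) \<notin> R"
    and above: "\<And>i j. i < j \<Longrightarrow> (a i, b j) \<in> R \<longleftrightarrow> (a i, c j) \<in> R"
  shows False
proof -
  obtain e :: "nat \<Rightarrow> nat" and t
    where e: "strict_mono e" and t: "\<And>i j. i < j \<Longrightarrow> (a (e i), b (e j)) \<in> R \<longleftrightarrow> t"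
    using exists_monochromatic_subsequence[of "\<lambda>i j. (a i, b j) \<in> R"] by blast
  have below_e: "(a (e j), b (e i)) \<in> R \<and> (a (e j), c (e i)) \<notin> R" if "i \<le> j" for i j
    using strict_mono_leD[OF e that] by (rule below)
  have above_e: "((a (e i), b (e j)) \<in> R \<longleftrightarrow> t) \<and> ((a (e i), c (e j)) \<in> R \<longleftrightarrow> t)" if "i < j" for i j
    using above[OF strict_monoD[OF e that]] t[OF that] by simp
  show False
  proof (cases t)
    case True
    have "(a (e i), c (e (Suc j))) \<in> R \<longleftrightarrow> i \<le> j" for i j
      using True below_e[of "Suc j" i] above_e[of i "Suc j"] by (cases "i \<le> j") auto
    then show False
      using stable_rel_no_infinite_ladder[OF stable in_VW(1,3), of e "\<lambda>j. e (Suc j)"] by simp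
  next
    case False
    have "(b (e i), a (e j)) \<in> R\<inverse> \<longleftrightarrow> i \<le> j" for i j
      using False below_e[of i j] above_e[of j i] by (cases "i \<le> j") auto
    then show False
      using stable_rel_no_infinite_ladder[OF stable_rel_converse[OF stable] in_VW(2,1), of e e]
      by simp
  qed
qed

definition fiber :: "'a set \<Rightarrow> ('a \<times> 'b) set \<Rightarrow> 'b \<Rightarrow> 'a set" where
  "fiber V R b = {x \<in> V. (x, b) \<in> R}"

lemma fiber_subset: "fiber V R b \<subseteq> V"
  by (auto simp: fiber_def)

lemma exists_realised_twins:
  assumes realised: "\<And>B. finite B \<Longrightarrow> B \<subseteq> W \<Longrightarrow> \<exists>a\<in>V. \<forall>b\<in>B. (a, b) \<in> R \<longleftrightarrow> b \<in> D"
    and twins: "\<exists>b\<in>W \<inter> D. \<exists>c\<in>W - D. fiber F R b = fiber F R c"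
    and B: "finite B" "B \<subseteq> W"
  shows "\<exists>a\<in>V. \<exists>b\<in>W \<inter> D. \<exists>c\<in>W - D. fiber F R b = fiber F R c \<and> (a, b) \<in> R \<and> (a, c) \<notin> R \<and>
    (\<forall>y\<in>B. (a, y) \<in> R \<longleftrightarrow> y \<in> D)"
proof -
  obtain b c where bc: "b \<in> W \<inter> D" "c \<in> W - D" "fiber F R b = fiber F R c"
    using twins by blast
  have "finite (insert b (insert c B))" "insert b (insert c B) \<subseteq> W" using B bc by auto
  from realised[OF this] obtain a
    where "a \<in> V" "\<forall>y\<in>insert b (insert c B). (a, y) \<in> R \<longleftrightarrow> y \<in> D"
    by blast
  with bc show ?thesis by blast
qed

text \<open>The hypothesis \<open>realised\<close> says that the type over \<open>W\<close> in which \<open>R(x,b)\<close> holds iff \<open>b \<in> D\<close> is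
  finitely satisfiable in \<open>V\<close>. If no \<open>F\<close> determined \<open>D\<close>, one could choose elements \<open>a\<^sub>i\<close>, \<open>b\<^sub>i \<in> D\<close>
  and \<open>c\<^sub>i \<notin> D\<close> such that \<open>b\<^sub>i\<close> and \<open>c\<^sub>i\<close> have the same fiber over the \<open>a\<^sub>j\<close> with \<open>j < i\<close>, and \<open>a\<^sub>i\<close>
  realises the type over the \<open>b\<^sub>j\<close>, \<open>c\<^sub>j\<close> with \<open>j \<le> i\<close>.\<close>

lemma stable_rel_fibers_determine:
  assumes stable: "stable_rel V W R"
    and realised: "\<And>B. finite B \<Longrightarrow> B \<subseteq> W \<Longrightarrow> \<exists>a\<in>V. \<forall>b\<in>B. (a, b) \<in> R \<longleftrightarrow> b \<in> D"
  shows "\<exists>F\<in>Fpow V. \<forall>b\<in>W. \<forall>c\<in>W. b \<in> D \<longrightarrow> fiber F R b = fiber F R c \<longrightarrow> c \<in> D"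
proof (rule ccontr)
  assume "\<not> ?thesis"
  then have twins: "\<exists>b\<in>W \<inter> D. \<exists>c\<in>W - D. fiber F R b = fiber F R c" if "F \<in> Fpow V" for F
    using that by blast
  define S where "S = {(a, b, c). a \<in> V \<and> b \<in> W \<inter> D \<and> c \<in> W - D \<and> (a, b) \<in> R \<and> (a, c) \<notin> R}"
  define P where "P = (\<lambda>(a, b, c) (a', b', c').
    ((a, b') \<in> R \<longleftrightarrow> (a, c') \<in> R) \<and> (a', b) \<in> R \<and> (a', c) \<notin> R)"
  have "\<exists>f :: nat \<Rightarrow> 'a \<times> 'b \<times> 'b. (\<forall>n. f n \<in> S) \<and> (\<forall>i j. i < j \<longrightarrow> P (f i) (f j))"
  proof (rule exists_pairwise_sequence)
    fix F assume F: "finite F" "F \<subseteq> S"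
    let ?B = "(\<lambda>(a, b, c). b) ` F \<union> (\<lambda>(a, b, c). c) ` F"
    have "fst ` F \<in> Fpow V" "finite ?B" "?B \<subseteq> W" using F by (auto simp: Fpow_def S_def)
    from exists_realised_twins[OF realised twins[OF this(1)] this(2,3)] obtain a b c
      where abc: "(a, b, c) \<in> S" and same: "fiber (fst ` F) R b = fiber (fst ` F) R c"
        and a: "\<forall>y\<in>?B. (a, y) \<in> R \<longleftrightarrow> y \<in> D"
      unfolding S_def by blast
    have "P x (a, b, c)" if "x \<in> F" for x
    proof -
      obtain a' b' c' where x: "x = (a', b', c')" by (cases x)
      have "b' \<in> D" "c' \<notin> D" using that F x by (auto simp: S_def)
      then have "(a, b') \<in> R" "(a, c') \<notin> R" using a that x by force+
      moreover have "(a', b) \<in> R \<longleftrightarrow> (a', c) \<in> R"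
        using same that x by (force simp: fiber_def)
      ultimately show ?thesis using x by (simp add: P_def)
    qed
    with abc show "\<exists>y\<in>S. \<forall>x\<in>F. P x y" by blast
  qed
  then obtain f :: "nat \<Rightarrow> 'a \<times> 'b \<times> 'b"
    where f: "\<And>n. f n \<in> S" and Pf: "\<And>i j. i < j \<Longrightarrow> P (f i) (f j)"
    by blast
  show False
  proof (rule stable_rel_no_twin_sequences[OF stable])
    show "fst (f i) \<in> V" "fst (snd (f i)) \<in> W" "snd (snd (f i)) \<in> W" for i
      using f[of i] by (auto simp: S_def)
    show "(fst (f j), fst (snd (f i))) \<in> R \<and> (fst (f j), snd (snd (f i))) \<notin> R" if "i \<le> j" for i j
      using f[of i] Pf[of i j] that by (cases "i = j") (auto simp: S_def P_def)
    show "(fst (f i), fst (snd (f j))) \<in> R \<longleftrightarrow> (fst (f i), snd (snd (f j))) \<in> R" if "i < j" for i j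
      using Pf[OF that] by (auto simp: P_def)
  qed
qed

lemma stable_rel_finite_definition:
  assumes "stable_rel V W R"
    and "\<And>B. finite B \<Longrightarrow> B \<subseteq> W \<Longrightarrow> \<exists>a\<in>V. \<forall>b\<in>B. (a, b) \<in> R \<longleftrightarrow> b \<in> D"
  shows "\<exists>F\<in>Fpow V. \<exists>T\<in>Fpow (Fpow V). \<forall>b\<in>W. b \<in> D \<longleftrightarrow> fiber F R b \<in> T"
proof -
  obtain F where F: "F \<in> Fpow V"
    and determines: "\<And>b c. b \<in> W \<Longrightarrow> c \<in> W \<Longrightarrow> b \<in> D \<Longrightarrow> fiber F R b = fiber F R c \<Longrightarrow> c \<in> D"
    using stable_rel_fibers_determine[OF assms] by blast
  have "fiber F R ` (D \<inter> W) \<subseteq> Pow F" by (auto simp: fiber_def)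
  then have "fiber F R ` (D \<inter> W) \<in> Fpow (Fpow V)"
    using F unfolding Fpow_def by (auto intro: finite_subset)
  moreover have "b \<in> D \<longleftrightarrow> fiber F R b \<in> fiber F R ` (D \<inter> W)" if "b \<in> W" for b
    using that determines by blast
  ultimately show ?thesis using F by blast
qed

lemma stable_rel_limit_definition:
  fixes a :: "nat \<Rightarrow> 'a" and b :: "nat \<Rightarrow> 'b"
  assumes stable: "stable_rel V W R" and a: "\<And>m. a m \<in> V" and b: "\<And>n. b n \<in> W"
    and limit: "\<And>n. \<forall>\<^sub>F m in sequentially. (a m, b n) \<in> R \<longleftrightarrow> n \<in> \<sigma>"
  shows "\<exists>F\<in>Fpow V. \<exists>T\<in>Fpow (Fpow V). \<forall>n. n \<in> \<sigma> \<longleftrightarrow> fiber F R (b n) \<in> T"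
proof -
  define D where "D = {y. \<forall>\<^sub>F m in sequentially. (a m, y) \<in> R}"
  have D_iff: "b n \<in> D \<longleftrightarrow> n \<in> \<sigma>" for n
    unfolding D_def mem_Collect_eq using eventually_cong[OF limit[of n]] by simp
  have "\<exists>F\<in>Fpow V. \<exists>T\<in>Fpow (Fpow V). \<forall>y\<in>range b. y \<in> D \<longleftrightarrow> fiber F R y \<in> T"
  proof (rule stable_rel_finite_definition)
    show "stable_rel V (range b) R"
      by (rule stable_rel_mono[OF stable]) (use b in blast)+
    fix B assume B: "finite B" "B \<subseteq> range b"
    have "\<forall>\<^sub>F m in sequentially. \<forall>y\<in>B. (a m, y) \<in> R \<longleftrightarrow> y \<in> D"
      using limit D_iff B(2) by (intro eventually_ball_finite[OF B(1)]) auto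
    then show "\<exists>x\<in>V. \<forall>y\<in>B. (x, y) \<in> R \<longleftrightarrow> y \<in> D"
      using eventually_happens'[OF sequentially_bot] a by blast
  qed
  then show ?thesis using D_iff by simp
qed

text \<open>A node of the binary tree is the list of the choices leading to it, the last choice first.\<close>

definition branch :: "nat set \<Rightarrow> nat \<Rightarrow> bool list" where
  "branch \<sigma> n = map (\<lambda>i. i \<in> \<sigma>) (rev [0..<n])"

lemma branch_0: "branch \<sigma> 0 = []" and branch_Suc: "branch \<sigma> (Suc n) = (n \<in> \<sigma>) # branch \<sigma> n"
  by (simp_all add: branch_def)

lemma branch_inject:
  assumes "\<And>n. branch \<sigma> n = branch \<tau> n \<Longrightarrow> n \<in> \<sigma> \<longleftrightarrow> n \<in> \<tau>"
  shows "\<sigma> = \<tau>"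
proof -
  have "branch \<sigma> n = branch \<tau> n" for n
    by (induction n) (simp_all add: branch_0 branch_Suc assms)
  with assms show ?thesis by blast
qed

lemma splitting_tree_branch:
  assumes split: "\<And>t l. T (t # l) \<subseteq> {x \<in> T l. (x, b l) \<in> R \<longleftrightarrow> t}"
    and "x \<in> T (branch \<sigma> m)" "n < m"
  shows "(x, b (branch \<sigma> n)) \<in> R \<longleftrightarrow> n \<in> \<sigma>"
  using assms(2,3)
proof (induction m)
  case (Suc m)
  then have "x \<in> T (branch \<sigma> m)" "(x, b (branch \<sigma> m)) \<in> R \<longleftrightarrow> m \<in> \<sigma>"
    using split by (auto simp: branch_Suc)
  with Suc show ?case by (cases "n = m") auto
qed simp

lemma uncountable_nat_set: "uncountable (UNIV :: nat set set)"
  using Cantors_theorem[of "UNIV :: nat set"] range_from_nat_into[of "UNIV :: nat set set"]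
  by (metis Pow_UNIV UNIV_not_empty)

text \<open>Each of the uncountably many branches of the tree is a type over its countably many nodes,
  and is determined by its finite definition.\<close>

lemma stable_rel_no_splitting_tree:
  fixes T :: "bool list \<Rightarrow> 'a set"
  assumes stable: "stable_rel V W R" and sub: "\<And>l. T l \<subseteq> V" and ne: "\<And>l. T l \<noteq> {}"
    and b: "\<And>l. b l \<in> W" and split: "\<And>t l. T (t # l) \<subseteq> {x \<in> T l. (x, b l) \<in> R \<longleftrightarrow> t}"
  shows False
proof -
  have "\<forall>l. \<exists>x. x \<in> T l" using ne by (simp add: ex_in_conv)
  then obtain a where a: "\<And>l. a l \<in> T l" by metis
  have stable_a: "stable_rel (range a) W R"
    by (rule stable_rel_mono[OF stable]) (use a sub in blast)+
  let ?defs = "Fpow (range a) \<times> Fpow (Fpow (range a))"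
  have "\<exists>FS\<in>?defs. \<forall>n. n \<in> \<sigma> \<longleftrightarrow> fiber (fst FS) R (b (branch \<sigma> n)) \<in> snd FS" for \<sigma>
  proof -
    have "\<forall>\<^sub>F m in sequentially. (a (branch \<sigma> m), b (branch \<sigma> n)) \<in> R \<longleftrightarrow> n \<in> \<sigma>" for n
      using eventually_gt_at_top[of n] by eventually_elim (rule splitting_tree_branch[OF split a])
    from stable_rel_limit_definition[OF stable_a _ _ this] b show ?thesis by fastforce
  qed
  then obtain d where d: "\<And>\<sigma>. d \<sigma> \<in> ?defs"
    and d_iff: "\<And>\<sigma> n. n \<in> \<sigma> \<longleftrightarrow> fiber (fst (d \<sigma>)) R (b (branch \<sigma> n)) \<in> snd (d \<sigma>)"
    by metis
  have "inj d"
  proof (rule injI, rule branch_inject)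
    fix \<sigma> \<tau> n assume "d \<sigma> = d \<tau>" "branch \<sigma> n = branch \<tau> n"
    then show "n \<in> \<sigma> \<longleftrightarrow> n \<in> \<tau>" using d_iff[of n \<sigma>] d_iff[of n \<tau>] by simp
  qed
  moreover have "countable ?defs"
    by (intro countable_SIGMA countable_Fpow countable_image) auto
  moreover have "range d \<subseteq> ?defs" using d by blast
  ultimately have "countable (UNIV :: nat set set)"
    using countable_image_inj_on countable_subset by blast
  with uncountable_nat_set show False ..
qed

lemma stable_rel_unsplit:
  assumes stable: "stable_rel V W R" and "\<X> \<subseteq> Pow V" "{} \<notin> \<X>" "\<X> \<noteq> {}"
  shows "\<exists>X\<in>\<X>. \<forall>b\<in>W. X \<inter> fiber V R b \<notin> \<X> \<or> X - fiber V R b \<notin> \<X>"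
proof (rule ccontr)
  assume "\<not> ?thesis"
  then obtain s where s: "\<And>X. X \<in> \<X> \<Longrightarrow> s X \<in> W \<and> X \<inter> fiber V R (s X) \<in> \<X> \<and> X - fiber V R (s X) \<in> \<X>"
    by metis
  obtain X\<^sub>0 where "X\<^sub>0 \<in> \<X>" using \<open>\<X> \<noteq> {}\<close> by blast
  define T where "T = rec_list X\<^sub>0
    (\<lambda>t (_ :: bool list) X. if t then X \<inter> fiber V R (s X) else X - fiber V R (s X))"
  have T_Cons: "T (t # l) = (if t then T l \<inter> fiber V R (s (T l)) else T l - fiber V R (s (T l)))"
    for t l
    by (simp add: T_def)
  have T: "T l \<in> \<X>" for l
    by (induction l) (use \<open>X\<^sub>0 \<in> \<X>\<close> s in \<open>auto simp: T_def\<close>)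
  show False
  proof (rule stable_rel_no_splitting_tree[OF stable])
    show TV: "T l \<subseteq> V" and "T l \<noteq> {}" for l using T[of l] assms(2,3) by auto
    show "s (T l) \<in> W" for l using s[OF T] by blast
    show "T (t # l) \<subseteq> {x \<in> T l. (x, s (T l)) \<in> R \<longleftrightarrow> t}" for t l
      using TV[of l] by (auto simp: T_Cons fiber_def)
  qed
qed

section \<open>Ultrafilters and ideals of an algebra of sets\<close>

definition ultrafilter_on :: "'a set \<Rightarrow> 'a set set \<Rightarrow> 'a set set \<Rightarrow> bool" where
  "ultrafilter_on \<Omega> M p \<longleftrightarrow> p \<subseteq> M \<and> {} \<notin> p \<and> (\<forall>X\<in>p. \<forall>Y\<in>p. X \<inter> Y \<in> p) \<and>
     (\<forall>X\<in>M. X \<in> p \<or> \<Omega> - X \<in> p)"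

definition set_ideal :: "'a set set \<Rightarrow> 'a set set \<Rightarrow> bool" where
  "set_ideal M I \<longleftrightarrow> I \<subseteq> M \<and> {} \<in> I \<and> (\<forall>X\<in>I. \<forall>Y\<in>I. X \<union> Y \<in> I) \<and>
     (\<forall>X\<in>I. \<forall>Y\<in>M. Y \<subseteq> X \<longrightarrow> Y \<in> I)"

context algebra
begin

lemma ultrafilter_sets: "ultrafilter_on \<Omega> M p \<Longrightarrow> X \<in> p \<Longrightarrow> X \<in> M"
  unfolding ultrafilter_on_def by blast

lemma ultrafilter_Int: "ultrafilter_on \<Omega> M p \<Longrightarrow> X \<in> p \<Longrightarrow> Y \<in> p \<Longrightarrow> X \<inter> Y \<in> p"
  unfolding ultrafilter_on_def by blast

lemma ultrafilter_compl_iff: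
  assumes "ultrafilter_on \<Omega> M p" "X \<in> M"
  shows "\<Omega> - X \<in> p \<longleftrightarrow> X \<notin> p"
proof -
  have "X \<inter> (\<Omega> - X) = {}" by blast
  with assms show ?thesis unfolding ultrafilter_on_def by metis
qed

lemma ultrafilter_superset:
  assumes "ultrafilter_on \<Omega> M p" "X \<in> p" "Y \<in> M" "X \<subseteq> Y"
  shows "Y \<in> p"
proof (rule ccontr)
  assume "Y \<notin> p"
  then have "X \<inter> (\<Omega> - Y) \<in> p"
    using ultrafilter_compl_iff ultrafilter_Int assms by blast
  moreover have "X \<inter> (\<Omega> - Y) = {}" using assms(4) by blast
  ultimately show False using assms(1) unfolding ultrafilter_on_def by simp
qed

lemma ultrafilter_space:
  assumes "ultrafilter_on \<Omega> M p"
  shows "\<Omega> \<in> p"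
proof -
  have "{} \<notin> p" using assms unfolding ultrafilter_on_def by simp
  then show ?thesis using ultrafilter_compl_iff[OF assms empty_sets] by simp
qed

lemma ultrafilter_decides:
  assumes "ultrafilter_on \<Omega> M p" "X \<in> M"
  shows "{x \<in> \<Omega>. x \<in> X \<longleftrightarrow> X \<in> p} \<in> p"
proof (cases "X \<in> p")
  case True
  then have "{x \<in> \<Omega>. x \<in> X \<longleftrightarrow> X \<in> p} = X" using sets_into_space[OF assms(2)] by blast
  with True show ?thesis by simp
next
  case False
  then have "{x \<in> \<Omega>. x \<in> X \<longleftrightarrow> X \<in> p} = \<Omega> - X" by blast
  with False show ?thesis using ultrafilter_compl_iff[OF assms] by simp
qed

lemma ultrafilter_Collect_finite_All:
  assumes "ultrafilter_on \<Omega> M p" "finite I" "\<And>i. i \<in> I \<Longrightarrow> {x \<in> \<Omega>. P i x} \<in> p"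
  shows "{x \<in> \<Omega>. \<forall>i\<in>I. P i x} \<in> p"
  using assms(2,3)
proof (induction I)
  case empty
  then show ?case using ultrafilter_space[OF assms(1)] by simp
next
  case (insert i I)
  have "{x \<in> \<Omega>. \<forall>i\<in>insert i I. P i x} = {x \<in> \<Omega>. P i x} \<inter> {x \<in> \<Omega>. \<forall>i\<in>I. P i x}" by auto
  then show ?case using insert by (simp add: ultrafilter_Int[OF assms(1)])
qed

lemma ideal_subset: "set_ideal M I \<Longrightarrow> X \<in> I \<Longrightarrow> Y \<in> M \<Longrightarrow> Y \<subseteq> X \<Longrightarrow> Y \<in> I"
  unfolding set_ideal_def by blast

lemma ideal_Un: "set_ideal M I \<Longrightarrow> X \<in> I \<Longrightarrow> Y \<in> I \<Longrightarrow> X \<union> Y \<in> I"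
  unfolding set_ideal_def by blast

lemma algebra_unsplitting_sets:
  assumes I: "set_ideal M I" and X: "X \<in> M"
  shows "algebra \<Omega> {Z \<in> M. X \<inter> Z \<in> I \<or> X - Z \<in> I}" (is "algebra \<Omega> ?S")
  unfolding algebra_iff_Un
proof (intro conjI ballI)
  show "?S \<subseteq> Pow \<Omega>" using sets_into_space by blast
  show "{} \<in> ?S" using I by (simp add: set_ideal_def)
next
  fix Z assume "Z \<in> ?S"
  moreover have "X \<inter> (\<Omega> - Z) = X - Z" "X - (\<Omega> - Z) = X \<inter> Z" using sets_into_space[OF X] by auto
  ultimately show "\<Omega> - Z \<in> ?S" by auto
next
  fix Y Z assume "Y \<in> ?S" "Z \<in> ?S"
  then have YZ: "Y \<in> M" "Z \<in> M" and "X \<inter> Y \<in> I \<or> X - Y \<in> I" "X \<inter> Z \<in> I \<or> X - Z \<in> I" by auto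
  then consider (inter) "X \<inter> Y \<in> I" "X \<inter> Z \<in> I" | (diff_Y) "X - Y \<in> I" | (diff_Z) "X - Z \<in> I"
    by blast
  then have "X \<inter> (Y \<union> Z) \<in> I \<or> X - (Y \<union> Z) \<in> I"
  proof cases
    case inter
    then show ?thesis using ideal_Un[OF I] by (simp add: Int_Un_distrib)
  next
    case diff_Y
    then show ?thesis using ideal_subset[OF I diff_Y, of "X - (Y \<union> Z)"] X YZ by blast
  next
    case diff_Z
    then show ?thesis using ideal_subset[OF I diff_Z, of "X - (Y \<union> Z)"] X YZ by blast
  qed
  with YZ show "Y \<union> Z \<in> ?S" by (simp add: Un)
qed

lemma ultrafilter_of_unsplit_set:
  assumes I: "set_ideal M I" and X: "X \<in> M" "X \<notin> I"
    and unsplit: "\<And>Z. Z \<in> M \<Longrightarrow> X \<inter> Z \<in> I \<or> X - Z \<in> I"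
  shows "ultrafilter_on \<Omega> M {Z \<in> M. X - Z \<in> I}" (is "ultrafilter_on \<Omega> M ?p")
  unfolding ultrafilter_on_def
proof (intro conjI ballI)
  show "{} \<notin> ?p" using X(2) by simp
next
  fix Y Z assume YZ: "Y \<in> ?p" "Z \<in> ?p"
  then have "(X - Y) \<union> (X - Z) \<in> I" by (intro ideal_Un[OF I]) auto
  with YZ show "Y \<inter> Z \<in> ?p" by (simp add: Diff_Int Int)
next
  fix Z assume "Z \<in> M"
  moreover have "X - (\<Omega> - Z) = X \<inter> Z" using sets_into_space[OF X(1)] by blast
  ultimately show "Z \<in> ?p \<or> \<Omega> - Z \<in> ?p"
    using unsplit[of Z] by auto
qed blast

end

text \<open>The ultrafilter condition says that \<open>X\<close> is an atom modulo the ideal \<open>I\<close>.\<close>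

definition superatomic :: "'a set \<Rightarrow> 'a set set \<Rightarrow> bool" where
  "superatomic \<Omega> M \<longleftrightarrow> (\<forall>I. set_ideal M I \<and> \<Omega> \<notin> I \<longrightarrow>
     (\<exists>X\<in>M - I. ultrafilter_on \<Omega> M {Z \<in> M. X - Z \<in> I}))"

section \<open>Finitely additive measures on superatomic algebras\<close>

definition concentrated ::
  "'a set \<Rightarrow> 'a set set \<Rightarrow> ('a set \<Rightarrow> real) \<Rightarrow> real \<Rightarrow> 'a set \<Rightarrow> 'a set set \<Rightarrow> bool" where
  "concentrated \<Omega> M \<mu> \<epsilon> X p \<longleftrightarrow> ultrafilter_on \<Omega> M p \<and> X \<in> p \<and> 0 < \<mu> X \<and>
     (\<forall>Z\<in>p. \<mu> (X - Z) \<le> \<epsilon> * \<mu> X)"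

locale finite_content = algebra \<Omega> M for \<Omega> :: "'a set" and M +
  fixes \<mu> :: "'a set \<Rightarrow> real"
  assumes nonneg: "X \<in> M \<Longrightarrow> 0 \<le> \<mu> X"
    and additive: "additive M \<mu>"
begin

lemma content_Un: "X \<in> M \<Longrightarrow> Y \<in> M \<Longrightarrow> X \<inter> Y = {} \<Longrightarrow> \<mu> (X \<union> Y) = \<mu> X + \<mu> Y"
  using additive by (auto simp: additive_def)

lemma content_empty: "\<mu> {} = 0"
  using content_Un[of "{}" "{}"] by simp

lemma content_split: "X \<in> M \<Longrightarrow> Y \<in> M \<Longrightarrow> \<mu> X = \<mu> (X \<inter> Y) + \<mu> (X - Y)"
  using content_Un[of "X \<inter> Y" "X - Y"] by (metis Diff Int Int_Diff_Un Int_Diff_disjoint)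

lemma content_mono: "X \<in> M \<Longrightarrow> Y \<in> M \<Longrightarrow> X \<subseteq> Y \<Longrightarrow> \<mu> X \<le> \<mu> Y"
  using content_split[of Y X] nonneg[of "Y - X"] by (simp add: Diff inf.absorb2)

lemma content_Un_le: "X \<in> M \<Longrightarrow> Y \<in> M \<Longrightarrow> \<mu> (X \<union> Y) \<le> \<mu> X + \<mu> Y"
  using content_Un[of X "Y - X"] content_mono[of "Y - X" Y] by (simp add: Diff)

lemma content_subalgebra:
  assumes "algebra \<Omega> A" "A \<subseteq> M"
  shows "finite_content \<Omega> A \<mu>"
proof -
  interpret A: algebra \<Omega> A by fact
  show ?thesis
    by unfold_locales (use nonneg additive assms(2) in \<open>auto simp: additive_def\<close>)
qed

lemma concentrated_sets: "concentrated \<Omega> M \<mu> \<epsilon> X p \<Longrightarrow> X \<in> M"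
  unfolding concentrated_def using ultrafilter_sets by blast

lemma concentrated_not_empty: "concentrated \<Omega> M \<mu> \<epsilon> X p \<Longrightarrow> X \<noteq> {}"
  unfolding concentrated_def ultrafilter_on_def by blast

lemma concentrated_mono:
  assumes "concentrated \<Omega> M \<mu> \<epsilon> X p" "\<epsilon> \<le> \<delta>"
  shows "concentrated \<Omega> M \<mu> \<delta> X p"
proof -
  have "\<epsilon> * \<mu> X \<le> \<delta> * \<mu> X" using assms by (intro mult_right_mono) (auto simp: concentrated_def)
  with assms(1) show ?thesis unfolding concentrated_def using order_trans by blast
qed

lemma concentrated_Un:
  assumes X: "concentrated \<Omega> M \<mu> \<epsilon> X p" and Y: "Y \<in> M" "\<mu> Y \<le> \<delta> * \<mu> X" and "0 \<le> \<epsilon>" "0 \<le> \<delta>"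
  shows "concentrated \<Omega> M \<mu> (\<epsilon> + \<delta>) (X \<union> Y) p"
proof -
  have p: "ultrafilter_on \<Omega> M p" and "X \<in> p" "0 < \<mu> X" and small: "\<And>Z. Z \<in> p \<Longrightarrow> \<mu> (X - Z) \<le> \<epsilon> * \<mu> X"
    using X by (auto simp: concentrated_def)
  have XM: "X \<in> M" using X by (rule concentrated_sets)
  have le: "\<mu> X \<le> \<mu> (X \<union> Y)" using XM Y(1) by (intro content_mono) auto
  have "\<mu> (X \<union> Y - Z) \<le> (\<epsilon> + \<delta>) * \<mu> (X \<union> Y)" if "Z \<in> p" for Z
  proof -
    have "Z \<in> M" using p that by (rule ultrafilter_sets)
    then have "\<mu> (X \<union> Y - Z) \<le> \<mu> (X - Z) + \<mu> Y"
      using content_Un_le[of "X - Z" "Y - Z"] content_mono[of "Y - Z" Y] XM Y(1)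
      by (simp add: Un_Diff Diff)
    also have "\<dots> \<le> (\<epsilon> + \<delta>) * \<mu> X" using small[OF that] Y(2) by (simp add: distrib_right)
    also have "\<dots> \<le> (\<epsilon> + \<delta>) * \<mu> (X \<union> Y)" using le assms(4,5) by (simp add: mult_left_mono)
    finally show ?thesis .
  qed
  moreover have "X \<union> Y \<in> p" using ultrafilter_superset[OF p \<open>X \<in> p\<close>] XM Y(1) by blast
  moreover have "0 < \<mu> (X \<union> Y)" using \<open>0 < \<mu> X\<close> le by simp
  ultimately show ?thesis using p by (simp add: concentrated_def)
qed

definition exhaustible :: "real \<Rightarrow> real \<Rightarrow> 'a set \<Rightarrow> bool" where
  "exhaustible \<epsilon> \<delta> X \<longleftrightarrow> (\<exists>P. finite P \<and> disjoint P \<and> \<Union>P \<subseteq> X \<and>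
     (\<forall>Y\<in>P. \<exists>p. concentrated \<Omega> M \<mu> \<epsilon> Y p) \<and> \<mu> (X - \<Union>P) \<le> \<delta>)"

lemma exhaustibleE:
  assumes "exhaustible \<epsilon> \<delta> X"
  obtains P where "finite P" "disjoint P" "\<Union>P \<subseteq> X" "\<forall>Y\<in>P. \<exists>p. concentrated \<Omega> M \<mu> \<epsilon> Y p"
    "\<mu> (X - \<Union>P) \<le> \<delta>"
  using assms unfolding exhaustible_def by (elim exE conjE) (rule that)

lemma concentrated_exhaustible:
  assumes "concentrated \<Omega> M \<mu> \<epsilon> X p" "0 \<le> \<delta>"
  shows "exhaustible \<epsilon> \<delta> X"
  unfolding exhaustible_def using assms content_empty by (intro exI[of _ "{X}"]) auto

lemma small_exhaustible: "\<mu> X \<le> \<delta> \<Longrightarrow> exhaustible \<epsilon> \<delta> X"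
  unfolding exhaustible_def by (intro exI[of _ "{}"]) simp

definition mass :: "'a set set \<Rightarrow> real" where
  "mass p = Inf (\<mu> ` p)"

lemma bdd_below_ultrafilter: "ultrafilter_on \<Omega> M p \<Longrightarrow> bdd_below (\<mu> ` p)"
  using nonneg ultrafilter_sets by (intro bdd_belowI2[of _ 0]) blast

lemma mass_le: "ultrafilter_on \<Omega> M p \<Longrightarrow> Z \<in> p \<Longrightarrow> mass p \<le> \<mu> Z"
  unfolding mass_def by (rule cINF_lower[OF bdd_below_ultrafilter])

lemma mass_less_member:
  assumes p: "ultrafilter_on \<Omega> M p" and X: "X \<in> p" and "mass p < r"
  shows "\<exists>Z\<in>p. Z \<subseteq> X \<and> \<mu> Z < r"
proof -
  have "p \<noteq> {}" using X by blast
  then have "\<exists>Z\<in>p. \<mu> Z < r"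
    using assms(3) bdd_below_ultrafilter[OF p] by (simp add: mass_def cINF_less_iff)
  then obtain Z where Z: "Z \<in> p" "\<mu> Z < r" by blast
  have ZX: "Z \<inter> X \<in> p" using p Z(1) X by (rule ultrafilter_Int)
  then have "\<mu> (Z \<inter> X) \<le> \<mu> Z"
    using Z(1) ultrafilter_sets[OF p] by (intro content_mono) auto
  with Z(2) ZX show ?thesis by (intro bexI[of _ "Z \<inter> X"]) auto
qed

lemma concentrated_if_near_mass:
  assumes p: "ultrafilter_on \<Omega> M p" and Z: "Z \<in> p" "\<mu> Z \<le> (1 + \<epsilon>) * mass p"
    and "0 < mass p" "0 \<le> \<epsilon>"
  shows "concentrated \<Omega> M \<mu> \<epsilon> Z p"
proof -
  have "\<mu> (Z - Y) \<le> \<epsilon> * \<mu> Z" if "Y \<in> p" for Y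
  proof -
    have "mass p \<le> \<mu> (Z \<inter> Y)" using mass_le[OF p] ultrafilter_Int[OF p Z(1) that] by blast
    then have "\<mu> (Z - Y) \<le> \<epsilon> * mass p"
      using content_split[of Z Y] ultrafilter_sets[OF p] Z that by (simp add: distrib_right)
    also have "\<dots> \<le> \<epsilon> * \<mu> Z" using mass_le[OF p Z(1)] \<open>0 \<le> \<epsilon>\<close> by (rule mult_left_mono)
    finally show ?thesis .
  qed
  moreover have "0 < \<mu> Z" using \<open>0 < mass p\<close> mass_le[OF p Z(1)] by simp
  ultimately show ?thesis using p Z(1) by (simp add: concentrated_def)
qed

lemma ultrafilter_exhaustible_member:
  assumes p: "ultrafilter_on \<Omega> M p" and X: "X \<in> p" and "0 < \<epsilon>" "0 < \<delta>"
  shows "\<exists>Z\<in>p. Z \<subseteq> X \<and> exhaustible \<epsilon> \<delta> Z"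
proof (cases "0 < mass p")
  case True
  then have "mass p < (1 + \<epsilon>) * mass p" using \<open>0 < \<epsilon>\<close> by simp
  then obtain Z where Z: "Z \<in> p" "Z \<subseteq> X" "\<mu> Z < (1 + \<epsilon>) * mass p"
    using mass_less_member[OF p X] by blast
  have "concentrated \<Omega> M \<mu> \<epsilon> Z p"
    using Z(3) True \<open>0 < \<epsilon>\<close> by (intro concentrated_if_near_mass[OF p Z(1)]) auto
  then have "exhaustible \<epsilon> \<delta> Z"
    using \<open>0 < \<delta>\<close> by (intro concentrated_exhaustible) auto
  with Z show ?thesis by blast
next
  case False
  then have "mass p < \<delta>" using \<open>0 < \<delta>\<close> by simp
  then obtain Z where "Z \<in> p" "Z \<subseteq> X" "\<mu> Z < \<delta>" using mass_less_member[OF p X] by blast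
  moreover from this have "exhaustible \<epsilon> \<delta> Z" by (intro small_exhaustible) simp
  ultimately show ?thesis by blast
qed

lemma Union_concentrated_sets:
  "finite P \<Longrightarrow> \<forall>Y\<in>P. \<exists>p. concentrated \<Omega> M \<mu> \<epsilon> Y p \<Longrightarrow> \<Union>P \<in> M"
  using concentrated_sets by (intro finite_Union) blast+

lemma exhaustible_Un:
  assumes X: "X \<in> M" "exhaustible \<epsilon> \<delta> X" and Y: "Y \<in> M" "exhaustible \<epsilon> \<delta>' Y"
    and disjoint: "X \<inter> Y = {}"
  shows "exhaustible \<epsilon> (\<delta> + \<delta>') (X \<union> Y)"
proof -
  obtain P where P: "finite P" "disjoint P" "\<Union>P \<subseteq> X"
    and concP: "\<forall>Z\<in>P. \<exists>p. concentrated \<Omega> M \<mu> \<epsilon> Z p" and restP: "\<mu> (X - \<Union>P) \<le> \<delta>"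
    using X(2) by (rule exhaustibleE)
  obtain Q where Q: "finite Q" "disjoint Q" "\<Union>Q \<subseteq> Y"
    and concQ: "\<forall>Z\<in>Q. \<exists>p. concentrated \<Omega> M \<mu> \<epsilon> Z p" and restQ: "\<mu> (Y - \<Union>Q) \<le> \<delta>'"
    using Y(2) by (rule exhaustibleE)
  have "X \<union> Y - \<Union>(P \<union> Q) = (X - \<Union>P) \<union> (Y - \<Union>Q)"
    using P(3) Q(3) disjoint by blast
  then have "\<mu> (X \<union> Y - \<Union>(P \<union> Q)) \<le> \<delta> + \<delta>'"
    using content_Un_le[of "X - \<Union>P" "Y - \<Union>Q"] restP restQ X(1) Y(1)
      Union_concentrated_sets[OF P(1) concP] Union_concentrated_sets[OF Q(1) concQ]
    by (simp add: Diff)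
  moreover have "\<Union>P \<inter> \<Union>Q = {}" using P(3) Q(3) disjoint by blast
  then have "disjoint (P \<union> Q)" by (rule disjoint_union[OF P(2) Q(2)])
  moreover have "\<Union>(P \<union> Q) \<subseteq> X \<union> Y" using P(3) Q(3) by blast
  moreover have "\<forall>Z\<in>P \<union> Q. \<exists>p. concentrated \<Omega> M \<mu> \<epsilon> Z p" using concP concQ by blast
  ultimately show ?thesis
    unfolding exhaustible_def using P(1) Q(1) by (intro exI[of _ "P \<union> Q"] conjI finite_UnI)
qed

definition exhaustible_ideal :: "real \<Rightarrow> 'a set set" where
  "exhaustible_ideal \<epsilon> = {X \<in> M. \<forall>Y\<in>M. Y \<subseteq> X \<longrightarrow> (\<forall>\<delta>>0. exhaustible \<epsilon> \<delta> Y)}"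

lemma exhaustible_idealD:
  "X \<in> exhaustible_ideal \<epsilon> \<Longrightarrow> Y \<in> M \<Longrightarrow> Y \<subseteq> X \<Longrightarrow> 0 < \<delta> \<Longrightarrow> exhaustible \<epsilon> \<delta> Y"
  unfolding exhaustible_ideal_def by blast

lemma set_ideal_exhaustible_ideal: "set_ideal M (exhaustible_ideal \<epsilon>)"
  unfolding set_ideal_def
proof (intro conjI ballI)
  show "{} \<in> exhaustible_ideal \<epsilon>"
    by (simp add: exhaustible_ideal_def small_exhaustible content_empty)
next
  fix X Y assume XY: "X \<in> exhaustible_ideal \<epsilon>" "Y \<in> exhaustible_ideal \<epsilon>"
  then have M: "X \<in> M" "Y \<in> M" by (auto simp: exhaustible_ideal_def)
  have "exhaustible \<epsilon> \<delta> Z" if Z: "Z \<in> M" "Z \<subseteq> X \<union> Y" and "0 < \<delta>" for Z \<delta>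
  proof -
    have "exhaustible \<epsilon> (\<delta> / 2) (Z \<inter> X)"
      by (rule exhaustible_idealD[OF XY(1)]) (use Z M \<open>0 < \<delta>\<close> in auto)
    moreover have "exhaustible \<epsilon> (\<delta> / 2) (Z - X)"
      by (rule exhaustible_idealD[OF XY(2)]) (use Z M \<open>0 < \<delta>\<close> in auto)
    ultimately have "exhaustible \<epsilon> (\<delta> / 2 + \<delta> / 2) (Z \<inter> X \<union> (Z - X))"
      using Z M by (intro exhaustible_Un) auto
    then show ?thesis by (simp add: Int_Diff_Un)
  qed
  with M show "X \<union> Y \<in> exhaustible_ideal \<epsilon>" by (simp add: exhaustible_ideal_def Un)
qed (auto simp: exhaustible_ideal_def)

lemma superatomic_exhaustible:
  assumes superatomic: "superatomic \<Omega> M" and "0 < \<epsilon>" "0 < \<delta>" "X \<in> M"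
  shows "exhaustible \<epsilon> \<delta> X"
proof -
  have "\<Omega> \<in> exhaustible_ideal \<epsilon>"
  proof (rule ccontr)
    assume "\<Omega> \<notin> exhaustible_ideal \<epsilon>"
    then obtain A p where A: "A \<in> M" "A \<notin> exhaustible_ideal \<epsilon>"
      and p: "ultrafilter_on \<Omega> M p" and p_def: "p = {Z \<in> M. A - Z \<in> exhaustible_ideal \<epsilon>}"
      using superatomic set_ideal_exhaustible_ideal unfolding superatomic_def by blast
    have "exhaustible \<epsilon> \<eta> Y" if Y: "Y \<in> M" "Y \<subseteq> A" and "0 < \<eta>" for Y \<eta>
    proof (cases "Y \<in> p")
      case True
      then obtain Z where Z: "Z \<in> p" "Z \<subseteq> Y" "exhaustible \<epsilon> (\<eta> / 2) Z"
        using ultrafilter_exhaustible_member[OF p True \<open>0 < \<epsilon>\<close>, of "\<eta> / 2"] \<open>0 < \<eta>\<close> by auto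
      have ZM: "Z \<in> M" using p Z(1) by (rule ultrafilter_sets)
      have "exhaustible \<epsilon> (\<eta> / 2) (Y - Z)"
        by (rule exhaustible_idealD[of "A - Z"]) (use Z(1) Y ZM \<open>0 < \<eta>\<close> in \<open>auto simp: p_def\<close>)
      then have "exhaustible \<epsilon> (\<eta> / 2 + \<eta> / 2) (Z \<union> (Y - Z))"
        using Z(3) ZM Y(1) by (intro exhaustible_Un) auto
      with Z(2) show ?thesis by (simp add: Un_absorb1)
    next
      case False
      then have "\<Omega> - Y \<in> p" using ultrafilter_compl_iff[OF p Y(1)] by simp
      moreover have "A - (\<Omega> - Y) = Y" using Y(2) sets_into_space[OF A(1)] by blast
      ultimately have "Y \<in> exhaustible_ideal \<epsilon>" by (simp add: p_def)
      then show ?thesis using exhaustible_idealD Y(1) \<open>0 < \<eta>\<close> by blast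
    qed
    with A show False by (simp add: exhaustible_ideal_def)
  qed
  then show ?thesis
    using exhaustible_idealD sets_into_space assms(3,4) by blast
qed

lemma superatomic_ex_concentrated:
  assumes "superatomic \<Omega> M" "0 < \<mu> \<Omega>" "0 < \<epsilon>"
  shows "\<exists>X p. concentrated \<Omega> M \<mu> \<epsilon> X p"
proof -
  have "exhaustible \<epsilon> (\<mu> \<Omega> / 2) \<Omega>"
    using assms by (intro superatomic_exhaustible) auto
  then obtain P where P: "\<forall>Y\<in>P. \<exists>p. concentrated \<Omega> M \<mu> \<epsilon> Y p" and "\<mu> (\<Omega> - \<Union>P) \<le> \<mu> \<Omega> / 2"
    by (rule exhaustibleE)
  then have "P \<noteq> {}" using \<open>0 < \<mu> \<Omega>\<close> by auto
  then obtain X where "X \<in> P" by blast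
  with P show ?thesis by blast
qed

lemma superatomic_concentrated_partition:
  assumes superatomic: "superatomic \<Omega> M" and "0 < \<mu> \<Omega>" "0 < \<epsilon>"
  shows "\<exists>P. finite P \<and> partition_on \<Omega> P \<and> (\<forall>X\<in>P. \<exists>p. concentrated \<Omega> M \<mu> \<epsilon> X p)"
proof -
  obtain A p where A: "concentrated \<Omega> M \<mu> (\<epsilon> / 2) A p"
    using superatomic_ex_concentrated[OF superatomic, of "\<epsilon> / 2"] assms(2,3) by auto
  have "A \<in> M" using A by (rule concentrated_sets)
  have "0 < \<mu> A" using A by (simp add: concentrated_def)
  then have "exhaustible (\<epsilon> / 2) (\<epsilon> / 2 * \<mu> A) (\<Omega> - A)"
    using superatomic \<open>A \<in> M\<close> \<open>0 < \<epsilon>\<close> by (intro superatomic_exhaustible) auto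
  then obtain P where P: "finite P" "disjoint P" "\<Union>P \<subseteq> \<Omega> - A"
    and concP: "\<forall>Y\<in>P. \<exists>p. concentrated \<Omega> M \<mu> (\<epsilon> / 2) Y p"
    and rest: "\<mu> (\<Omega> - A - \<Union>P) \<le> \<epsilon> / 2 * \<mu> A"
    by (rule exhaustibleE)
  define B where "B = A \<union> (\<Omega> - A - \<Union>P)"
  have "\<Union>P \<in> M" using P(1) concP by (rule Union_concentrated_sets)
  then have "concentrated \<Omega> M \<mu> (\<epsilon> / 2 + \<epsilon> / 2) B p"
    unfolding B_def using rest \<open>A \<in> M\<close> \<open>0 < \<epsilon>\<close> by (intro concentrated_Un[OF A]) auto
  then have B: "concentrated \<Omega> M \<mu> \<epsilon> B p" by simp
  have "\<epsilon> / 2 \<le> \<epsilon>" using \<open>0 < \<epsilon>\<close> by simp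
  with B concP have conc: "\<forall>Y\<in>insert B P. \<exists>p. concentrated \<Omega> M \<mu> \<epsilon> Y p"
    using concentrated_mono by fast
  have "partition_on \<Omega> (insert B P)"
    unfolding partition_on_def
  proof (intro conjI)
    show "\<Union>(insert B P) = \<Omega>"
      using P(3) sets_into_space[OF \<open>A \<in> M\<close>] unfolding B_def by blast
    have "disjnt B Y" if "Y \<in> P" for Y
      using that P(3) unfolding B_def disjnt_def by blast
    then show "disjoint (insert B P)"
      using P(2) by (auto simp: pairwise_insert disjnt_sym)
    show "{} \<notin> insert B P"
      using conc concentrated_not_empty by fast
  qed
  with P(1) conc show ?thesis by blast
qed

end

section \<open>Definability of types and symmetry\<close>

lemma algebra_boolean_combinations:
  assumes "G \<subseteq> Pow U" "G \<noteq> {}"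
  shows "algebra U (boolean_combinations U G)"
  unfolding algebra_iff_Un
proof (intro conjI ballI)
  have "X \<subseteq> U" if "X \<in> boolean_combinations U G" for X
    using that assms(1) by induction auto
  then show "boolean_combinations U G \<subseteq> Pow U" by blast
  obtain X where "X \<in> boolean_combinations U G"
    using assms(2) by (auto intro: boolean_combinations.gen)
  then have "X \<inter> (U - X) \<in> boolean_combinations U G"
    by (intro boolean_combinations.inter boolean_combinations.compl)
  then show "{} \<in> boolean_combinations U G" by simp
qed (auto intro: boolean_combinations.intros)

lemma boolean_combinations_least:
  assumes "algebra U A" "G \<subseteq> A"
  shows "boolean_combinations U G \<subseteq> A"
proof
  interpret algebra U A by fact
  fix X assume "X \<in> boolean_combinations U G"
  then show "X \<in> A" by induction (use assms in auto)
qed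

text \<open>There are no Boolean combinations of an empty family, so \<open>V\<close> itself has to be among the
  generators to obtain an algebra when \<open>W\<close> is empty.\<close>

definition fiber_algebra :: "'a set \<Rightarrow> 'b set \<Rightarrow> ('a \<times> 'b) set \<Rightarrow> 'a set set" where
  "fiber_algebra V W R = boolean_combinations V (insert V (fiber V R ` W))"

lemma algebra_fiber_algebra: "algebra V (fiber_algebra V W R)"
  unfolding fiber_algebra_def
  by (rule algebra_boolean_combinations) (auto simp: fiber_def)

lemma fiber_in_fiber_algebra: "b \<in> W \<Longrightarrow> fiber V R b \<in> fiber_algebra V W R"
  unfolding fiber_algebra_def by (simp add: boolean_combinations.gen)

lemma fiber_algebra_least:
  assumes "algebra V A" "\<And>b. b \<in> W \<Longrightarrow> fiber V R b \<in> A"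
  shows "fiber_algebra V W R \<subseteq> A"
proof -
  interpret algebra V A by fact
  show ?thesis
    unfolding fiber_algebra_def using assms by (intro boolean_combinations_least) auto
qed

lemma superatomic_fiber_algebra:
  assumes stable: "stable_rel V W R"
  shows "superatomic V (fiber_algebra V W R)"
  unfolding superatomic_def
proof (intro allI impI, elim conjE)
  let ?A = "fiber_algebra V W R"
  interpret algebra V ?A by (rule algebra_fiber_algebra)
  fix I assume I: "set_ideal ?A I" and "V \<notin> I"
  have "\<exists>X\<in>?A - I. \<forall>b\<in>W. X \<inter> fiber V R b \<notin> ?A - I \<or> X - fiber V R b \<notin> ?A - I"
  proof (rule stable_rel_unsplit[OF stable])
    show "?A - I \<subseteq> Pow V" using space_closed by blast
    show "{} \<notin> ?A - I" using I by (simp add: set_ideal_def)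
    show "?A - I \<noteq> {}" using top \<open>V \<notin> I\<close> by blast
  qed
  then obtain X where X: "X \<in> ?A" "X \<notin> I"
    and unsplit: "\<And>b. b \<in> W \<Longrightarrow> X \<inter> fiber V R b \<notin> ?A - I \<or> X - fiber V R b \<notin> ?A - I"
    by blast
  have "?A \<subseteq> {Z \<in> ?A. X \<inter> Z \<in> I \<or> X - Z \<in> I}"
  proof (rule fiber_algebra_least[OF algebra_unsplitting_sets[OF I X(1)]])
    fix b assume "b \<in> W"
    then have "fiber V R b \<in> ?A" by (rule fiber_in_fiber_algebra)
    then show "fiber V R b \<in> {Z \<in> ?A. X \<inter> Z \<in> I \<or> X - Z \<in> I}"
      using unsplit[OF \<open>b \<in> W\<close>] X(1) by auto
  qed
  then have "ultrafilter_on V ?A {Z \<in> ?A. X - Z \<in> I}"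
    by (intro ultrafilter_of_unsplit_set[OF I X]) blast
  with X show "\<exists>X\<in>?A - I. ultrafilter_on V ?A {Z \<in> ?A. X - Z \<in> I}" by blast
qed

definition defining_set :: "'a set \<Rightarrow> 'b set \<Rightarrow> ('a \<times> 'b) set \<Rightarrow> 'a set set \<Rightarrow> 'b set" where
  "defining_set V W R p = {b \<in> W. fiber V R b \<in> p}"

lemma ultrafilter_fiber_decides:
  assumes p: "ultrafilter_on V (fiber_algebra V W R) p" and "b \<in> W"
  shows "{a \<in> V. (a, b) \<in> R \<longleftrightarrow> b \<in> defining_set V W R p} \<in> p"
proof -
  interpret algebra V "fiber_algebra V W R" by (rule algebra_fiber_algebra)
  have "{a \<in> V. (a, b) \<in> R \<longleftrightarrow> b \<in> defining_set V W R p} =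
      {a \<in> V. a \<in> fiber V R b \<longleftrightarrow> fiber V R b \<in> p}"
    using \<open>b \<in> W\<close> by (auto simp: fiber_def defining_set_def)
  then show ?thesis
    using ultrafilter_decides[OF p fiber_in_fiber_algebra[OF \<open>b \<in> W\<close>]] by simp
qed

lemma ultrafilter_realise:
  assumes p: "ultrafilter_on V (fiber_algebra V W R) p" and X: "X \<in> p"
    and B: "finite B" "B \<subseteq> W"
  shows "\<exists>a\<in>X. a \<in> V \<and> (\<forall>b\<in>B. (a, b) \<in> R \<longleftrightarrow> b \<in> defining_set V W R p)"
proof -
  interpret algebra V "fiber_algebra V W R" by (rule algebra_fiber_algebra)
  have "{a \<in> V. \<forall>b\<in>B. (a, b) \<in> R \<longleftrightarrow> b \<in> defining_set V W R p} \<in> p"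
    using B ultrafilter_fiber_decides[OF p] by (intro ultrafilter_Collect_finite_All[OF p]) auto
  then have "X \<inter> {a \<in> V. \<forall>b\<in>B. (a, b) \<in> R \<longleftrightarrow> b \<in> defining_set V W R p} \<in> p"
    by (rule ultrafilter_Int[OF p X])
  moreover have "{} \<notin> p" using p by (simp add: ultrafilter_on_def)
  ultimately have "X \<inter> {a \<in> V. \<forall>b\<in>B. (a, b) \<in> R \<longleftrightarrow> b \<in> defining_set V W R p} \<noteq> {}" by metis
  then show ?thesis by blast
qed

lemma defining_set_in_fiber_algebra:
  assumes stable: "stable_rel V W R" and p: "ultrafilter_on V (fiber_algebra V W R) p"
  shows "defining_set V W R p \<in> fiber_algebra W V (R\<inverse>)"
proof -
  interpret V: algebra V "fiber_algebra V W R" by (rule algebra_fiber_algebra)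
  interpret W: algebra W "fiber_algebra W V (R\<inverse>)" by (rule algebra_fiber_algebra)
  let ?D = "defining_set V W R p"
  have "\<exists>a\<in>V. \<forall>b\<in>B. (a, b) \<in> R \<longleftrightarrow> b \<in> ?D" if "finite B" "B \<subseteq> W" for B
    using ultrafilter_realise[OF p V.ultrafilter_space[OF p] that] by blast
  from stable_rel_finite_definition[OF stable this] obtain F T
    where "F \<in> Fpow V" "T \<in> Fpow (Fpow V)" and D_iff: "\<forall>b\<in>W. b \<in> ?D \<longleftrightarrow> fiber F R b \<in> T"
    by blast
  then have fin: "finite F" "F \<subseteq> V" "finite T" by (auto simp: Fpow_def)
  have R_iff: "{b \<in> W. (a, b) \<in> R \<longleftrightarrow> a \<in> S} \<in> fiber_algebra W V (R\<inverse>)" if "a \<in> F" for a S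
  proof -
    have "{b \<in> W. (a, b) \<in> R} = fiber W (R\<inverse>) a" by (auto simp: fiber_def)
    then have "{b \<in> W. (a, b) \<in> R} \<in> fiber_algebra W V (R\<inverse>)"
      using fiber_in_fiber_algebra[of a V W "R\<inverse>"] that fin(2) by auto
    then show ?thesis using W.sets_Collect_neg by (cases "a \<in> S") simp_all
  qed
  have "?D = {b \<in> W. \<exists>S\<in>T. fiber F R b = S}" using D_iff by (auto simp: defining_set_def)
  also have "\<dots> = {b \<in> W. \<exists>S\<in>T. S \<subseteq> F \<and> (\<forall>a\<in>F. (a, b) \<in> R \<longleftrightarrow> a \<in> S)}"
    by (intro Collect_cong conj_cong bex_cong refl) (auto simp: fiber_def)
  also have "\<dots> \<in> fiber_algebra W V (R\<inverse>)"
    by (intro W.sets_Collect_finite_Ex W.sets_Collect_conj W.sets_Collect_finite_All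
        W.sets_Collect_const R_iff fin(1,3))
  finally show ?thesis .
qed

text \<open>If the conclusion failed, realising alternately \<open>p\<close> and \<open>q\<close> over the elements found so far
  would produce a ladder.\<close>

lemma defining_set_symmetric_imp:
  assumes stable: "stable_rel V W R"
    and p: "ultrafilter_on V (fiber_algebra V W R) p"
    and q: "ultrafilter_on W (fiber_algebra W V (R\<inverse>)) q"
    and Ep: "defining_set W V (R\<inverse>) q \<in> p"
  shows "defining_set V W R p \<in> q"
proof (rule ccontr)
  interpret W: algebra W "fiber_algebra W V (R\<inverse>)" by (rule algebra_fiber_algebra)
  let ?D = "defining_set V W R p" and ?E = "defining_set W V (R\<inverse>) q"
  assume "?D \<notin> q"
  then have Dq: "W - ?D \<in> q"
    using W.ultrafilter_compl_iff[OF q defining_set_in_fiber_algebra[OF stable p]] by simp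
  define S where "S = {(a, b). a \<in> V \<inter> ?E \<and> b \<in> W - ?D \<and> (a, b) \<in> R}"
  have "\<exists>f :: nat \<Rightarrow> 'a \<times> 'b. (\<forall>n. f n \<in> S) \<and>
      (\<forall>i j. i < j \<longrightarrow> (fst (f i), snd (f j)) \<in> R \<and> (fst (f j), snd (f i)) \<notin> R)"
  proof (rule exists_pairwise_sequence)
    fix F assume F: "finite F" "F \<subseteq> S"
    have "finite (snd ` F)" "snd ` F \<subseteq> W" using F by (auto simp: S_def)
    from ultrafilter_realise[OF p Ep this]
    obtain a where a: "a \<in> ?E" "a \<in> V" "\<forall>y\<in>snd ` F. (a, y) \<in> R \<longleftrightarrow> y \<in> ?D" by blast
    have "finite (insert a (fst ` F))" "insert a (fst ` F) \<subseteq> V" using F a(2) by (auto simp: S_def)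
    from ultrafilter_realise[OF q Dq this]
    obtain b where b: "b \<in> W - ?D" "\<forall>x\<in>insert a (fst ` F). (b, x) \<in> R\<inverse> \<longleftrightarrow> x \<in> ?E" by blast
    have "(a, b) \<in> S" using a b by (simp add: S_def)
    moreover have "(fst y, b) \<in> R \<and> (a, snd y) \<notin> R" if "y \<in> F" for y
      using a(3) b(2) F(2) that by (auto simp: S_def)
    ultimately show "\<exists>x\<in>S. \<forall>y\<in>F. (fst y, snd x) \<in> R \<and> (fst x, snd y) \<notin> R" by force
  qed
  then obtain f :: "nat \<Rightarrow> 'a \<times> 'b" where f: "\<And>n. f n \<in> S"
    and below: "\<And>i j. i < j \<Longrightarrow> (fst (f i), snd (f j)) \<in> R \<and> (fst (f j), snd (f i)) \<notin> R"
    by blast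
  have f_in: "fst (f i) \<in> V" "snd (f i) \<in> W" "(fst (f i), snd (f i)) \<in> R" for i
    using f[of i] by (auto simp: S_def)
  have "(fst (f i), snd (f j)) \<in> R \<longleftrightarrow> i \<le> j" for i j
    using below[of i j] below[of j i] f_in(3)[of i] by (cases i j rule: linorder_cases) auto
  then show False
    using stable_rel_no_infinite_ladder[OF stable f_in(1,2), of id id] by simp
qed

lemma defining_set_symmetric:
  assumes "stable_rel V W R" "ultrafilter_on V (fiber_algebra V W R) p"
    "ultrafilter_on W (fiber_algebra W V (R\<inverse>)) q"
  shows "defining_set W V (R\<inverse>) q \<in> p \<longleftrightarrow> defining_set V W R p \<in> q"
  using defining_set_symmetric_imp[OF assms]
    defining_set_symmetric_imp[OF stable_rel_converse[OF assms(1)] assms(3), of p] assms(2) by auto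

section \<open>Regularity for finitely additive measures\<close>

lemma almost_all_mono:
  assumes "almost_all D \<mu> \<epsilon> X P" "D \<subseteq> D'" "\<epsilon> \<le> \<delta>" "0 \<le> \<mu> X" "\<And>a. a \<in> X \<Longrightarrow> P a \<Longrightarrow> Q a"
  shows "almost_all D' \<mu> \<delta> X Q"
proof -
  obtain E where "E \<in> D" "\<mu> E \<le> \<epsilon> * \<mu> X" "\<forall>a\<in>X - E. P a"
    using assms(1) unfolding almost_all_def by blast
  moreover have "\<epsilon> * \<mu> X \<le> \<delta> * \<mu> X" using assms(3,4) by (rule mult_right_mono)
  ultimately have "E \<in> D' \<and> \<mu> E \<le> \<delta> * \<mu> X \<and> (\<forall>a\<in>X - E. Q a)" using assms(2,5) by auto
  then show ?thesis unfolding almost_all_def by blast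
qed

lemma almost_all_pairs_mono:
  assumes "almost_all_pairs D \<mu> E \<nu> \<epsilon> X Y P" "D \<subseteq> D'" "E \<subseteq> E'" "\<epsilon> \<le> \<delta>" "0 \<le> \<mu> X" "0 \<le> \<nu> Y"
  shows "almost_all_pairs D' \<mu> E' \<nu> \<delta> X Y P"
proof -
  have "almost_all E' \<nu> \<delta> Y (P a)" if "almost_all E \<nu> \<epsilon> Y (P a)" for a
    using almost_all_mono[OF that assms(3,4,6)] .
  moreover have "almost_all D' \<mu> \<delta> X (\<lambda>a. P a b)" if "almost_all D \<mu> \<epsilon> X (\<lambda>a. P a b)" for b
    using almost_all_mono[OF that assms(2,4,5)] .
  ultimately show ?thesis
    using assms unfolding almost_all_pairs_def by (blast intro: almost_all_mono)
qed

lemma (in finite_content) almost_all_conj_ex: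
  assumes "almost_all M \<mu> \<epsilon> X P" "almost_all M \<mu> \<delta> X Q" "X \<in> M" "0 < \<mu> X" "\<epsilon> + \<delta> < 1"
  shows "\<exists>a\<in>X. P a \<and> Q a"
proof (rule ccontr)
  assume neg: "\<not> ?thesis"
  obtain E where E: "E \<in> M" "\<mu> E \<le> \<epsilon> * \<mu> X" "\<forall>a\<in>X - E. P a"
    using assms(1) unfolding almost_all_def by blast
  obtain F where F: "F \<in> M" "\<mu> F \<le> \<delta> * \<mu> X" "\<forall>a\<in>X - F. Q a"
    using assms(2) unfolding almost_all_def by blast
  have "X \<subseteq> E \<union> F" using neg E(3) F(3) by blast
  then have "\<mu> X \<le> \<mu> E + \<mu> F"
    using content_mono[OF assms(3) Un[OF E(1) F(1)]] content_Un_le[OF E(1) F(1)] by simp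
  also have "\<dots> \<le> (\<epsilon> + \<delta>) * \<mu> X" using E(2) F(2) by (simp add: algebra_simps)
  also have "\<dots> < 1 * \<mu> X" using assms(4,5) by (rule mult_strict_right_mono[rotated])
  finally show False by simp
qed

lemma almost_all_pairs_exclusive:
  assumes "finite_content V D \<mu>" "finite_content W E \<nu>"
    and X: "X \<in> D" "0 < \<mu> X" and Y: "Y \<in> E" "0 < \<nu> Y" and "\<epsilon> + \<delta> < 1"
    and "almost_all_pairs D \<mu> E \<nu> \<epsilon> X Y P" "almost_all_pairs D \<mu> E \<nu> \<delta> X Y (\<lambda>a b. \<not> P a b)"
  shows False
proof -
  obtain a where "almost_all E \<nu> \<epsilon> Y (P a)" "almost_all E \<nu> \<delta> Y (\<lambda>b. \<not> P a b)"
    using finite_content.almost_all_conj_ex[OF assms(1) _ _ X \<open>\<epsilon> + \<delta> < 1\<close>] assms(8,9)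
    unfolding almost_all_pairs_def by blast
  then show False
    using finite_content.almost_all_conj_ex[OF assms(2) _ _ Y \<open>\<epsilon> + \<delta> < 1\<close>] by blast
qed

lemma (in algebra) almost_all_concentrated:
  assumes X: "concentrated \<Omega> M \<mu> \<epsilon> X p" and Z: "Z \<in> p" and P: "\<And>a. a \<in> X \<Longrightarrow> a \<in> Z \<Longrightarrow> P a"
  shows "almost_all M \<mu> \<epsilon> X P"
proof -
  have p: "ultrafilter_on \<Omega> M p" "X \<in> p" and small: "\<mu> (X - Z) \<le> \<epsilon> * \<mu> X"
    using X Z by (auto simp: concentrated_def)
  have "X - Z \<in> M" using ultrafilter_sets[OF p(1)] p(2) Z by blast
  then show ?thesis
    unfolding almost_all_def using small P by (intro bexI[of _ "X - Z"]) auto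
qed

lemma almost_all_iterated_concentrated:
  fixes V :: "'a set" and W :: "'b set" and R :: "('a \<times> 'b) set"
  defines "A \<equiv> fiber_algebra V W R" and "B \<equiv> fiber_algebra W V (R\<inverse>)"
  assumes stable: "stable_rel V W R"
    and X: "concentrated V A \<mu> \<epsilon> X p" and Y: "concentrated W B \<nu> \<epsilon> Y q"
  shows "almost_all A \<mu> \<epsilon> X (\<lambda>a. almost_all B \<nu> \<epsilon> Y
    (\<lambda>b. (a, b) \<in> R \<longleftrightarrow> defining_set W V (R\<inverse>) q \<in> p))"
proof -
  interpret V: algebra V A unfolding A_def by (rule algebra_fiber_algebra)
  interpret W: algebra W B unfolding B_def by (rule algebra_fiber_algebra)
  let ?E = "defining_set W V (R\<inverse>) q"
  have p: "ultrafilter_on V A p" and q: "ultrafilter_on W B q"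
    using X Y by (auto simp: concentrated_def)
  have "?E \<in> A"
    using defining_set_in_fiber_algebra[OF stable_rel_converse[OF stable] q[unfolded B_def]]
    by (simp add: A_def)
  from V.ultrafilter_decides[OF p this] show ?thesis
  proof (rule V.almost_all_concentrated[OF X])
    fix a assume a: "a \<in> {a \<in> V. a \<in> ?E \<longleftrightarrow> ?E \<in> p}"
    then have "{b \<in> W. (b, a) \<in> R\<inverse> \<longleftrightarrow> a \<in> ?E} \<in> q"
      using ultrafilter_fiber_decides[OF q[unfolded B_def]] by blast
    then show "almost_all B \<nu> \<epsilon> Y (\<lambda>b. (a, b) \<in> R \<longleftrightarrow> ?E \<in> p)"
      by (rule W.almost_all_concentrated[OF Y]) (use a in auto)
  qed
qed

lemma almost_all_pairs_concentrated:
  assumes stable: "stable_rel V W R"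
    and X: "concentrated V (fiber_algebra V W R) \<mu> \<epsilon> X p"
    and Y: "concentrated W (fiber_algebra W V (R\<inverse>)) \<nu> \<epsilon> Y q"
  shows "almost_all_pairs (fiber_algebra V W R) \<mu> (fiber_algebra W V (R\<inverse>)) \<nu> \<epsilon> X Y
    (\<lambda>a b. (a, b) \<in> R \<longleftrightarrow> defining_set W V (R\<inverse>) q \<in> p)"
proof -
  have "defining_set W V (R\<inverse>) q \<in> p \<longleftrightarrow> defining_set V W R p \<in> q"
    using X Y by (intro defining_set_symmetric[OF stable]) (auto simp: concentrated_def)
  then show ?thesis
    using almost_all_iterated_concentrated[OF stable X Y]
      almost_all_iterated_concentrated[OF stable_rel_converse[OF stable] Y,
        unfolded converse_converse, OF X]
    unfolding almost_all_pairs_def by simp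
qed

theorem stable_regularity:
  fixes V :: "'a set" and W :: "'b set" and R :: "('a \<times> 'b) set"
  defines "A \<equiv> fiber_algebra V W R" and "B \<equiv> fiber_algebra W V (R\<inverse>)"
  assumes stable: "stable_rel V W R"
    and \<mu>: "finite_content V A \<mu>" "0 < \<mu> V" and \<nu>: "finite_content W B \<nu>" "0 < \<nu> W" and "0 < \<epsilon>"
  shows "\<exists>P Q. finite P \<and> partition_on V P \<and> (\<forall>X\<in>P. X \<in> A \<and> 0 < \<mu> X) \<and>
      finite Q \<and> partition_on W Q \<and> (\<forall>Y\<in>Q. Y \<in> B \<and> 0 < \<nu> Y) \<and>
      (\<forall>X\<in>P. \<forall>Y\<in>Q. almost_all_pairs A \<mu> B \<nu> \<epsilon> X Y (\<lambda>a b. (a, b) \<in> R) \<or>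
         almost_all_pairs A \<mu> B \<nu> \<epsilon> X Y (\<lambda>a b. (a, b) \<notin> R))"
proof -
  interpret V: finite_content V A \<mu> by fact
  interpret W: finite_content W B \<nu> by fact
  obtain P where P: "finite P" "partition_on V P"
    and concP: "\<forall>X\<in>P. \<exists>p. concentrated V A \<mu> \<epsilon> X p"
    using V.superatomic_concentrated_partition[OF _ \<mu>(2) \<open>0 < \<epsilon>\<close>]
      superatomic_fiber_algebra[OF stable] unfolding A_def by blast
  obtain Q where Q: "finite Q" "partition_on W Q"
    and concQ: "\<forall>Y\<in>Q. \<exists>q. concentrated W B \<nu> \<epsilon> Y q"
    using W.superatomic_concentrated_partition[OF _ \<nu>(2) \<open>0 < \<epsilon>\<close>]
      superatomic_fiber_algebra[OF stable_rel_converse[OF stable]] unfolding B_def by blast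
  have "almost_all_pairs A \<mu> B \<nu> \<epsilon> X Y (\<lambda>a b. (a, b) \<in> R) \<or>
      almost_all_pairs A \<mu> B \<nu> \<epsilon> X Y (\<lambda>a b. (a, b) \<notin> R)" if XY: "X \<in> P" "Y \<in> Q" for X Y
  proof -
    obtain p q where "concentrated V A \<mu> \<epsilon> X p" "concentrated W B \<nu> \<epsilon> Y q"
      using concP concQ XY by blast
    from almost_all_pairs_concentrated[OF stable this[unfolded A_def B_def]] show ?thesis
      by (cases "defining_set W V (R\<inverse>) q \<in> p") (simp_all add: A_def B_def)
  qed
  moreover have "\<forall>X\<in>P. X \<in> A \<and> 0 < \<mu> X"
    using concP V.concentrated_sets concentrated_def by blast
  moreover have "\<forall>Y\<in>Q. Y \<in> B \<and> 0 < \<nu> Y"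
    using concQ W.concentrated_sets concentrated_def by blast
  ultimately show ?thesis using P Q by (intro exI[of _ P] exI[of _ Q]) blast
qed

lemma almost_all_pairs_dichotomy:
  assumes \<mu>: "finite_content V D \<mu>" and \<nu>: "finite_content W E \<nu>"
    and X: "X \<in> D" "0 < \<mu> X" and Y: "Y \<in> E" "0 < \<nu> Y"
    and \<delta>: "\<delta> \<le> \<epsilon>" "\<epsilon> < 1 \<Longrightarrow> \<delta> + \<epsilon> < 1"
    and alternative: "almost_all_pairs D \<mu> E \<nu> \<delta> X Y P \<or>
      almost_all_pairs D \<mu> E \<nu> \<delta> X Y (\<lambda>a b. \<not> P a b)"
  defines "pos \<equiv> almost_all_pairs D \<mu> E \<nu> \<epsilon> X Y P"
    and "neg \<equiv> almost_all_pairs D \<mu> E \<nu> \<epsilon> X Y (\<lambda>a b. \<not> P a b)"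
  shows "(pos \<or> neg) \<and> (\<epsilon> < 1 \<longrightarrow> \<not> (pos \<and> neg))"
proof -
  have weaken: "almost_all_pairs D \<mu> E \<nu> \<epsilon> X Y S" if "almost_all_pairs D \<mu> E \<nu> \<delta> X Y S" for S
    using almost_all_pairs_mono[OF that order_refl order_refl \<delta>(1)] X(2) Y(2) by simp
  have exclusive: "\<not> almost_all_pairs D \<mu> E \<nu> \<epsilon> X Y (\<lambda>a b. \<not> S a b)"
    if "\<epsilon> < 1" "almost_all_pairs D \<mu> E \<nu> \<delta> X Y S" for S
    using almost_all_pairs_exclusive[OF \<mu> \<nu> X Y \<delta>(2)[OF that(1)] that(2)] by blast
  from alternative show ?thesis
  proof
    assume "almost_all_pairs D \<mu> E \<nu> \<delta> X Y P"
    then show ?thesis using weaken exclusive unfolding pos_def neg_def by blast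
  next
    assume "almost_all_pairs D \<mu> E \<nu> \<delta> X Y (\<lambda>a b. \<not> P a b)"
    then show ?thesis
      using weaken exclusive[of "\<lambda>a b. \<not> P a b"] unfolding pos_def neg_def by auto
  qed
qed

theorem stable_regularity_dichotomy:
  fixes V :: "'a set" and W :: "'b set" and R :: "('a \<times> 'b) set"
  defines "A \<equiv> fiber_algebra V W R" and "B \<equiv> fiber_algebra W V (R\<inverse>)"
  assumes stable: "stable_rel V W R"
    and \<mu>: "finite_content V D \<mu>" "0 < \<mu> V" "A \<subseteq> D"
    and \<nu>: "finite_content W E \<nu>" "0 < \<nu> W" "B \<subseteq> E" and "0 < \<epsilon>"
  defines "pos X Y \<equiv> almost_all_pairs D \<mu> E \<nu> \<epsilon> X Y (\<lambda>a b. (a, b) \<in> R)"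
    and "neg X Y \<equiv> almost_all_pairs D \<mu> E \<nu> \<epsilon> X Y (\<lambda>a b. (a, b) \<notin> R)"
  shows "\<exists>P Q. finite P \<and> partition_on V P \<and> P \<subseteq> A \<and> finite Q \<and> partition_on W Q \<and> Q \<subseteq> B \<and>
      (\<forall>X\<in>P. \<forall>Y\<in>Q. (pos X Y \<or> neg X Y) \<and> (\<epsilon> < 1 \<longrightarrow> \<not> (pos X Y \<and> neg X Y)))"
proof -
  have content: "finite_content V A \<mu>" "finite_content W B \<nu>"
    using \<mu>(3) \<nu>(3) unfolding A_def B_def
    by (auto intro: algebra_fiber_algebra finite_content.content_subalgebra[OF \<mu>(1)]
        finite_content.content_subalgebra[OF \<nu>(1)])
  \<comment> \<open>For \<open>\<epsilon> < 1\<close> the two alternatives at level \<open>\<epsilon>\<close> exclude each other once one of them holds at a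
    level \<open>\<delta> < 1 - \<epsilon>\<close>.\<close>
  define \<delta> where "\<delta> = (if \<epsilon> < 1 then min \<epsilon> ((1 - \<epsilon>) / 2) else \<epsilon>)"
  have \<delta>: "0 < \<delta>" "\<delta> \<le> \<epsilon>" "\<epsilon> < 1 \<Longrightarrow> \<delta> + \<epsilon> < 1"
    using \<open>0 < \<epsilon>\<close> by (auto simp: \<delta>_def min_def field_simps)
  obtain P Q where P: "finite P" "partition_on V P" "\<forall>X\<in>P. X \<in> A \<and> 0 < \<mu> X"
    and Q: "finite Q" "partition_on W Q" "\<forall>Y\<in>Q. Y \<in> B \<and> 0 < \<nu> Y"
    and regular: "\<forall>X\<in>P. \<forall>Y\<in>Q. almost_all_pairs A \<mu> B \<nu> \<delta> X Y (\<lambda>a b. (a, b) \<in> R) \<or>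
      almost_all_pairs A \<mu> B \<nu> \<delta> X Y (\<lambda>a b. (a, b) \<notin> R)"
    using stable_regularity[OF stable content(1)[unfolded A_def] \<mu>(2)
        content(2)[unfolded B_def] \<nu>(2) \<delta>(1)]
    unfolding A_def B_def by blast
  have "(pos X Y \<or> neg X Y) \<and> (\<epsilon> < 1 \<longrightarrow> \<not> (pos X Y \<and> neg X Y))" if XY: "X \<in> P" "Y \<in> Q" for X Y
  proof -
    have X: "X \<in> D" "0 < \<mu> X" and Y: "Y \<in> E" "0 < \<nu> Y" using XY P(3) Q(3) \<mu>(3) \<nu>(3) by blast+
    have "almost_all_pairs D \<mu> E \<nu> \<delta> X Y S" if "almost_all_pairs A \<mu> B \<nu> \<delta> X Y S" for S
      using almost_all_pairs_mono[OF that \<mu>(3) \<nu>(3) order_refl] X(2) Y(2) by simp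
    with regular XY show ?thesis
      unfolding pos_def neg_def
      by (intro almost_all_pairs_dichotomy[OF \<mu>(1) \<nu>(1) X Y \<delta>(2,3)]) blast+
  qed
  moreover have "P \<subseteq> A" "Q \<subseteq> B" using P(3) Q(3) by blast+
  ultimately show ?thesis using P(1,2) Q(1,2) by (intro exI[of _ P] exI[of _ Q]) blast
qed

section \<open>Definable sets\<close>

lemma tm_val_cong:
  "(\<And>i. i \<in> tm_vars t \<Longrightarrow> e i = e' i) \<Longrightarrow> tm_val M e t = tm_val M e' t"
proof (induction t)
  case (App f ts)
  then have "map (tm_val M e) ts = map (tm_val M e') ts" by (intro map_cong) auto
  then show ?case by (simp only: tm_val.simps)
qed simp_all

lemma sat_cong:
  "(\<And>i. i \<in> free_vars \<phi> \<Longrightarrow> e i = e' i) \<Longrightarrow> sat M e \<phi> \<longleftrightarrow> sat M e' \<phi>"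
proof (induction \<phi> arbitrary: e e')
  case (Equal s t)
  then have "tm_val M e s = tm_val M e' s" "tm_val M e t = tm_val M e' t"
    by (auto intro!: tm_val_cong)
  then show ?case by simp
next
  case (Rel r ts)
  then have "map (tm_val M e) ts = map (tm_val M e') ts" by (intro map_cong refl tm_val_cong) auto
  then show ?case by (simp only: sat.simps)
next
  case (Neg \<phi>)
  have "sat M e \<phi> \<longleftrightarrow> sat M e' \<phi>" by (rule Neg.IH) (use Neg.prems in simp)
  then show ?case by simp
next
  case (Conj \<phi> \<psi>)
  have "sat M e \<phi> \<longleftrightarrow> sat M e' \<phi>" "sat M e \<psi> \<longleftrightarrow> sat M e' \<psi>"
    by (rule Conj.IH; use Conj.prems in simp)+
  then show ?case by simp
next
  case (Exi i \<phi>)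
  have "sat M (e(i := a)) \<phi> \<longleftrightarrow> sat M (e'(i := a)) \<phi>" for a
    by (rule Exi.IH) (use Exi.prems in auto)
  then show ?case by simp
qed

lemma tm_val_in_univ:
  assumes "is_structure L M"
  shows "wf_tm L t \<Longrightarrow> tm_params t \<subseteq> univ M \<Longrightarrow> (\<And>i. i \<in> tm_vars t \<Longrightarrow> e i \<in> univ M) \<Longrightarrow>
    tm_val M e t \<in> univ M"
proof (induction t)
  case (App f ts)
  have "tm_val M e t \<in> univ M" if "t \<in> set ts" for t
    using that App.prems by (intro App.IH) auto
  then have "set (map (tm_val M e) ts) \<subseteq> univ M" by auto
  with assms App.prems(1) show ?case by (simp add: is_structure_def)
qed simp_all

primrec subst_tm :: "(nat \<Rightarrow> ('f, 'm) tm) \<Rightarrow> ('f, 'm) tm \<Rightarrow> ('f, 'm) tm" where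
  "subst_tm s (Var i) = s i"
| "subst_tm s (Param a) = Param a"
| "subst_tm s (App f ts) = App f (map (subst_tm s) ts)"

text \<open>Bound variables are shifted by \<open>m\<close>, so that nothing is captured when the free variables are
  replaced by terms in the variables below \<open>m\<close>.\<close>

primrec subst_fm :: "nat \<Rightarrow> (nat \<Rightarrow> ('f, 'm) tm) \<Rightarrow> ('f, 'r, 'm) fm \<Rightarrow> ('f, 'r, 'm) fm" where
  "subst_fm m s (Equal t u) = Equal (subst_tm s t) (subst_tm s u)"
| "subst_fm m s (Rel r ts) = Rel r (map (subst_tm s) ts)"
| "subst_fm m s (Neg \<phi>) = Neg (subst_fm m s \<phi>)"
| "subst_fm m s (Conj \<phi> \<psi>) = Conj (subst_fm m s \<phi>) (subst_fm m s \<psi>)"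
| "subst_fm m s (Exi i \<phi>) = Exi (m + i) (subst_fm m (s(i := Var (m + i))) \<phi>)"

lemma tm_val_subst: "tm_val M e (subst_tm s t) = tm_val M (\<lambda>i. tm_val M e (s i)) t"
proof (induction t)
  case (App f ts)
  then have "map (tm_val M e \<circ> subst_tm s) ts = map (tm_val M (\<lambda>i. tm_val M e (s i))) ts"
    by (intro map_cong refl) (simp add: comp_def)
  then show ?case by (simp only: subst_tm.simps tm_val.simps map_map)
qed simp_all

lemma sat_subst:
  "(\<And>j. j \<in> free_vars \<phi> \<Longrightarrow> tm_vars (s j) \<subseteq> {..<m} \<or> s j = Var (m + j)) \<Longrightarrow>
    sat M e (subst_fm m s \<phi>) \<longleftrightarrow> sat M (\<lambda>j. tm_val M e (s j)) \<phi>"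
proof (induction \<phi> arbitrary: e s)
  case (Exi i \<phi>)
  let ?s = "s(i := Var (m + i))"
  have "sat M (e(m + i := a)) (subst_fm m ?s \<phi>) \<longleftrightarrow> sat M ((\<lambda>j. tm_val M e (s j))(i := a)) \<phi>" for a
  proof -
    have unchanged: "tm_val M (e(m + i := a)) (s j) = tm_val M e (s j)"
      if "j \<in> free_vars \<phi>" "j \<noteq> i" for j
      using Exi.prems[of j] that by (intro tm_val_cong) auto
    have "sat M (e(m + i := a)) (subst_fm m ?s \<phi>) \<longleftrightarrow> sat M (\<lambda>j. tm_val M (e(m + i := a)) (?s j)) \<phi>"
      by (rule Exi.IH) (use Exi.prems in auto)
    also have "\<dots> \<longleftrightarrow> sat M ((\<lambda>j. tm_val M e (s j))(i := a)) \<phi>"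
      by (rule sat_cong) (use unchanged in auto)
    finally show ?thesis .
  qed
  then show ?case by simp
qed (simp_all add: tm_val_subst comp_def)

lemma wf_tm_subst: "wf_tm L t \<Longrightarrow> (\<And>i. i \<in> tm_vars t \<Longrightarrow> wf_tm L (s i)) \<Longrightarrow> wf_tm L (subst_tm s t)"
  by (induction t) auto

lemma wf_fm_subst:
  "wf_fm L \<phi> \<Longrightarrow> (\<And>i. i \<in> free_vars \<phi> \<Longrightarrow> wf_tm L (s i)) \<Longrightarrow> wf_fm L (subst_fm m s \<phi>)"
  by (induction \<phi> arbitrary: s) (auto intro!: wf_tm_subst)

lemma tm_params_subst: "tm_params (subst_tm s t) = tm_params t \<union> (\<Union>i\<in>tm_vars t. tm_params (s i))"
  by (induction t) auto

lemma params_subst: "params (subst_fm m s \<phi>) = params \<phi> \<union> (\<Union>i\<in>free_vars \<phi>. tm_params (s i))"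
  by (induction \<phi> arbitrary: s) (auto simp: tm_params_subst split: if_splits)

lemma tm_vars_subst: "tm_vars (subst_tm s t) = (\<Union>i\<in>tm_vars t. tm_vars (s i))"
  by (induction t) auto

lemma free_vars_subst: "free_vars (subst_fm m s \<phi>) \<subseteq> (\<Union>i\<in>free_vars \<phi>. tm_vars (s i))"
proof (induction \<phi> arbitrary: s)
  case (Exi i \<phi>)
  then show ?case using Exi.IH[of "s(i := Var (m + i))"] by (fastforce split: if_splits)
next
  case (Conj \<phi> \<psi>)
  show ?case unfolding subst_fm.simps free_vars.simps UN_Un by (intro Un_mono Conj.IH)
qed (auto simp: tm_vars_subst)

lemma definableE:
  assumes "definable L M n X"
  obtains \<phi> where "wf_fm L \<phi>" "params \<phi> \<subseteq> univ M" "free_vars \<phi> \<subseteq> {..<n}"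
    "X = {a. length a = n \<and> set a \<subseteq> univ M \<and> sat M (\<lambda>i. a ! i) \<phi>}"
proof -
  obtain \<phi> where "\<phi> \<in> formulas_over L (univ M) n"
    "X = {a. length a = n \<and> set a \<subseteq> univ M \<and> sat M (\<lambda>i. a ! i) \<phi>}"
    using assms unfolding definable_def by (rule bexE)
  then show thesis by (intro that[of \<phi>]) (simp_all add: formulas_over_def)
qed

lemma definableI:
  assumes "wf_fm L \<phi>" "params \<phi> \<subseteq> univ M" "free_vars \<phi> \<subseteq> {..<n}"
    "X = {a. length a = n \<and> set a \<subseteq> univ M \<and> sat M (\<lambda>i. a ! i) \<phi>}"
  shows "definable L M n X"
  unfolding definable_def by (rule bexI[of _ \<phi>]) (use assms in \<open>simp_all add: formulas_over_def\<close>)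

lemma definable_tuple:
  assumes "definable L M n X" "a \<in> X"
  shows "length a = n" "set a \<subseteq> univ M"
proof -
  from assms(1) obtain \<phi> where "X = {a. length a = n \<and> set a \<subseteq> univ M \<and> sat M (\<lambda>i. a ! i) \<phi>}"
    by (rule definableE)
  with assms(2) show "length a = n" "set a \<subseteq> univ M" by simp_all
qed

lemma definable_Diff:
  assumes "definable L M n X" "definable L M n Y"
  shows "definable L M n (X - Y)"
proof -
  obtain \<phi> where \<phi>: "wf_fm L \<phi>" "params \<phi> \<subseteq> univ M" "free_vars \<phi> \<subseteq> {..<n}"
    "X = {a. length a = n \<and> set a \<subseteq> univ M \<and> sat M (\<lambda>i. a ! i) \<phi>}"
    using assms(1) by (rule definableE)
  obtain \<psi> where \<psi>: "wf_fm L \<psi>" "params \<psi> \<subseteq> univ M" "free_vars \<psi> \<subseteq> {..<n}"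
    "Y = {a. length a = n \<and> set a \<subseteq> univ M \<and> sat M (\<lambda>i. a ! i) \<psi>}"
    using assms(2) by (rule definableE)
  show ?thesis by (rule definableI[of _ "Conj \<phi> (Neg \<psi>)"]) (use \<phi> \<psi> in auto)
qed

lemma definable_Int:
  assumes "definable L M n X" "definable L M n Y"
  shows "definable L M n (X \<inter> Y)"
  using definable_Diff[OF assms(1) definable_Diff[OF assms]] by (simp add: Diff_Diff_Int)

lemma algebra_definable_subsets:
  assumes V: "definable L M n V"
  shows "algebra V (definable_subsets L M n V)"
  unfolding algebra_iff_Int
proof (intro conjI ballI)
  show "{} \<in> definable_subsets L M n V"
    using definable_Diff[OF V V] by (simp add: definable_subsets_def)
qed (use V in \<open>auto simp: definable_subsets_def definable_Int definable_Diff\<close>)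

lemma definable_vimage_terms:
  assumes M: "is_structure L M" and X: "definable L M (length ts) X"
    and ts: "\<And>t. t \<in> set ts \<Longrightarrow> wf_tm L t \<and> tm_params t \<subseteq> univ M \<and> tm_vars t \<subseteq> {..<m}"
  shows "definable L M m {a. length a = m \<and> set a \<subseteq> univ M \<and> map (tm_val M (\<lambda>i. a ! i)) ts \<in> X}"
proof -
  obtain \<phi> where \<phi>: "wf_fm L \<phi>" "params \<phi> \<subseteq> univ M" "free_vars \<phi> \<subseteq> {..<length ts}"
    and X_eq: "X = {a. length a = length ts \<and> set a \<subseteq> univ M \<and> sat M (\<lambda>i. a ! i) \<phi>}"
    using X by (rule definableE)
  let ?\<psi> = "subst_fm m (\<lambda>i. ts ! i) \<phi>"
  have ts_nth: "wf_tm L (ts ! i) \<and> tm_params (ts ! i) \<subseteq> univ M \<and> tm_vars (ts ! i) \<subseteq> {..<m}"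
    if "i \<in> free_vars \<phi>" for i
    by (rule ts) (use that \<phi>(3) in auto)
  have "map (tm_val M (\<lambda>i. a ! i)) ts \<in> X \<longleftrightarrow> sat M (\<lambda>i. a ! i) ?\<psi>"
    if a: "length a = m" "set a \<subseteq> univ M" for a
  proof -
    have "tm_val M (\<lambda>i. a ! i) t \<in> univ M" if "t \<in> set ts" for t
    proof (rule tm_val_in_univ[OF M])
      fix i assume "i \<in> tm_vars t"
      then show "a ! i \<in> univ M" using ts[OF that] a by (auto simp: subset_iff)
    qed (use ts[OF that] in simp_all)
    then have "map (tm_val M (\<lambda>i. a ! i)) ts \<in> X \<longleftrightarrow>
        sat M (\<lambda>i. map (tm_val M (\<lambda>i. a ! i)) ts ! i) \<phi>"
      by (auto simp: X_eq)
    also have "\<dots> \<longleftrightarrow> sat M (\<lambda>i. tm_val M (\<lambda>i. a ! i) (ts ! i)) \<phi>"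
      by (rule sat_cong) (use \<phi>(3) in auto)
    also have "\<dots> \<longleftrightarrow> sat M (\<lambda>i. a ! i) ?\<psi>"
      by (rule sat_subst[symmetric]) (use ts_nth in blast)
    finally show ?thesis .
  qed
  then have "{a. length a = m \<and> set a \<subseteq> univ M \<and> map (tm_val M (\<lambda>i. a ! i)) ts \<in> X} =
      {a. length a = m \<and> set a \<subseteq> univ M \<and> sat M (\<lambda>i. a ! i) ?\<psi>}"
    by blast
  moreover have "wf_fm L ?\<psi>" using \<phi>(1) ts_nth by (intro wf_fm_subst) auto
  moreover have "params ?\<psi> \<subseteq> univ M" using \<phi>(2) ts_nth by (auto simp: params_subst)
  moreover have "free_vars ?\<psi> \<subseteq> {..<m}" using free_vars_subst[of m "\<lambda>i. ts ! i" \<phi>] ts_nth by blast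
  ultimately show ?thesis by (intro definableI)
qed

lemma definable_rel_append_iff:
  assumes "definable_rel L M n k R" "length a = n"
  shows "a @ b \<in> {a @ b |a b. (a, b) \<in> R} \<longleftrightarrow> (a, b) \<in> R"
proof
  assume "a @ b \<in> {a @ b |a b. (a, b) \<in> R}"
  then obtain c d where cd: "(c, d) \<in> R" "a @ b = c @ d" by blast
  then have "length c = n" using assms(1) by (auto simp: definable_rel_def)
  with cd assms(2) show "(a, b) \<in> R" by simp
qed blast

lemma definable_rel_vimage_terms:
  assumes M: "is_structure L M" and R: "definable_rel L M (length ts) (length us) R"
    and terms: "\<And>t. t \<in> set ts \<union> set us \<Longrightarrow> wf_tm L t \<and> tm_params t \<subseteq> univ M \<and> tm_vars t \<subseteq> {..<m}"
  shows "definable L M m {a. length a = m \<and> set a \<subseteq> univ M \<and>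
    (map (tm_val M (\<lambda>i. a ! i)) ts, map (tm_val M (\<lambda>i. a ! i)) us) \<in> R}"
proof -
  have "definable L M (length (ts @ us)) {a @ b |a b. (a, b) \<in> R}"
    using R by (simp add: definable_rel_def)
  from definable_vimage_terms[OF M this, of m] terms show ?thesis
    by (simp only: set_append map_append definable_rel_append_iff[OF R] length_map)
qed

lemma map_tm_val_Var: "length a = n \<Longrightarrow> map (tm_val M (\<lambda>i. a ! i)) (map Var [0..<n]) = a"
  using map_nth[of a] by (simp add: comp_def)

lemma map_tm_val_Param: "map (tm_val M e) (map Param b) = b"
  by (simp add: comp_def)

lemma definable_fiber:
  assumes M: "is_structure L M" and V: "definable L M n V" and W: "definable L M k W"
    and R: "definable_rel L M n k R" "R \<subseteq> V \<times> W" and "b \<in> W"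
  shows "fiber V R b \<in> definable_subsets L M n V"
proof -
  have b: "length b = k" "set b \<subseteq> univ M" using definable_tuple[OF W \<open>b \<in> W\<close>] by simp_all
  have "fiber V R b = {a. length a = n \<and> set a \<subseteq> univ M \<and> (a, b) \<in> R}"
    using R(2) definable_tuple[OF V] unfolding fiber_def by blast
  also have "\<dots> = {a. length a = n \<and> set a \<subseteq> univ M \<and>
      (map (tm_val M (\<lambda>i. a ! i)) (map Var [0..<n]), map (tm_val M (\<lambda>i. a ! i)) (map Param b)) \<in> R}"
    by (simp only: map_tm_val_Var map_tm_val_Param cong: conj_cong)
  also have "definable L M n \<dots>"
    by (rule definable_rel_vimage_terms[OF M]) (use R(1) b in auto)
  finally show ?thesis by (simp add: definable_subsets_def fiber_subset)
qed

lemma definable_converse_fiber: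
  assumes M: "is_structure L M" and V: "definable L M n V" and W: "definable L M k W"
    and R: "definable_rel L M n k R" "R \<subseteq> V \<times> W" and "a \<in> V"
  shows "fiber W (R\<inverse>) a \<in> definable_subsets L M k W"
proof -
  have a: "length a = n" "set a \<subseteq> univ M" using definable_tuple[OF V \<open>a \<in> V\<close>] by simp_all
  have "fiber W (R\<inverse>) a = {b. length b = k \<and> set b \<subseteq> univ M \<and> (a, b) \<in> R}"
    using R(2) definable_tuple[OF W] unfolding fiber_def by blast
  also have "\<dots> = {b. length b = k \<and> set b \<subseteq> univ M \<and>
      (map (tm_val M (\<lambda>i. b ! i)) (map Param a), map (tm_val M (\<lambda>i. b ! i)) (map Var [0..<k])) \<in> R}"
    by (simp only: map_tm_val_Var map_tm_val_Param cong: conj_cong)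
  also have "definable L M k \<dots>"
    by (rule definable_rel_vimage_terms[OF M]) (use R(1) a in auto)
  finally show ?thesis by (simp add: definable_subsets_def fiber_subset)
qed

lemma keisler_measureD:
  assumes "keisler_measure L M n V \<mu>" "definable L M n V"
  shows "finite_content V (definable_subsets L M n V) \<mu>" "0 < \<mu> V" "V \<noteq> {}"
proof -
  show content: "finite_content V (definable_subsets L M n V) \<mu>"
    using algebra_definable_subsets[OF assms(2)] assms(1)
    by (simp add: finite_content_def finite_content_axioms_def keisler_measure_def)
  show pos: "0 < \<mu> V" using assms(1) by (simp add: keisler_measure_def)
  show "V \<noteq> {}" using finite_content.content_empty[OF content] pos by auto
qed

lemma fiber_algebra_subset_Delta_sets:
  assumes "V \<noteq> {}"
  shows "fiber_algebra V W R \<subseteq> Delta_sets V W R"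
  unfolding Delta_sets_def
proof (rule fiber_algebra_least)
  let ?G = "{{x \<in> V. (x, b) \<in> R} |b. b \<in> W} \<union> {{x \<in> V. x = a} |a. a \<in> V}"
  show "algebra V (boolean_combinations V ?G)"
    by (rule algebra_boolean_combinations) (use assms in auto)
  show "fiber V R b \<in> boolean_combinations V ?G" if "b \<in> W" for b
    by (rule boolean_combinations.gen) (use that in \<open>auto simp: fiber_def\<close>)
qed

lemma Delta_star_sets_eq: "Delta_star_sets V W R = Delta_sets W V (R\<inverse>)"
  by (simp add: Delta_star_sets_def Delta_sets_def)

theorem theorem1p1:
  fixes L :: "('f, 'r) language" and M :: "('f, 'r, 'm) struct"
    and n k :: nat and V W :: "'m list set" and R :: "('m list \<times> 'm list) set"
    and \<mu> \<nu> :: "'m list set \<Rightarrow> real" and \<epsilon> :: real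
  assumes "is_structure L M" and "saturated L M"
    and "definable L M n V" and "definable L M k W"
    and "definable_rel L M n k R" and "R \<subseteq> V \<times> W"
    and "stable_rel V W R"
    and "keisler_measure L M n V \<mu>" and "keisler_measure L M k W \<nu>"
    and "\<epsilon> > 0"
  shows "\<exists>P Q. finite P \<and> partition_on V P \<and>
      (\<forall>X\<in>P. X \<in> definable_subsets L M n V \<and> X \<in> Delta_sets V W R) \<and>
      finite Q \<and> partition_on W Q \<and>
      (\<forall>Y\<in>Q. Y \<in> definable_subsets L M k W \<and> Y \<in> Delta_star_sets V W R) \<and>
      (\<forall>X\<in>P. \<forall>Y\<in>Q.
        let pos = almost_all_pairs (definable_subsets L M n V) \<mu> (definable_subsets L M k W) \<nu> \<epsilon> X Y
                    (\<lambda>a b. (a, b) \<in> R);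
            neg = almost_all_pairs (definable_subsets L M n V) \<mu> (definable_subsets L M k W) \<nu> \<epsilon> X Y
                    (\<lambda>a b. (a, b) \<notin> R)
        in (pos \<or> neg) \<and> (\<epsilon> < 1 \<longrightarrow> \<not> (pos \<and> neg)))"
proof -
  let ?D = "definable_subsets L M n V" and ?E = "definable_subsets L M k W"
  note \<mu> = keisler_measureD[OF assms(8,3)] and \<nu> = keisler_measureD[OF assms(9,4)]
  have D: "fiber_algebra V W R \<subseteq> ?D"
    using definable_fiber[OF assms(1,3-6)]
    by (rule fiber_algebra_least[OF algebra_definable_subsets[OF assms(3)]])
  have E: "fiber_algebra W V (R\<inverse>) \<subseteq> ?E"
    using definable_converse_fiber[OF assms(1,3-6)]
    by (rule fiber_algebra_least[OF algebra_definable_subsets[OF assms(4)]])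
  obtain P Q where "finite P" "partition_on V P" "finite Q" "partition_on W Q"
    and "P \<subseteq> fiber_algebra V W R" "Q \<subseteq> fiber_algebra W V (R\<inverse>)"
    and "\<forall>X\<in>P. \<forall>Y\<in>Q. let pos = almost_all_pairs ?D \<mu> ?E \<nu> \<epsilon> X Y (\<lambda>a b. (a, b) \<in> R);
        neg = almost_all_pairs ?D \<mu> ?E \<nu> \<epsilon> X Y (\<lambda>a b. (a, b) \<notin> R)
      in (pos \<or> neg) \<and> (\<epsilon> < 1 \<longrightarrow> \<not> (pos \<and> neg))"
    using stable_regularity_dichotomy[OF assms(7) \<mu>(1,2) D \<nu>(1,2) E assms(10)]
    unfolding Let_def by metis
  moreover have "fiber_algebra V W R \<subseteq> Delta_sets V W R"
    using \<mu>(3) by (rule fiber_algebra_subset_Delta_sets)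
  moreover have "fiber_algebra W V (R\<inverse>) \<subseteq> Delta_star_sets V W R"
    unfolding Delta_star_sets_eq using \<nu>(3) by (rule fiber_algebra_subset_Delta_sets)
  ultimately show ?thesis using D E by (intro exI[of _ P] exI[of _ Q]) (simp add: subset_iff)
qed

end
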